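(* Let $P$ and $Q$ be Borel probability measures on $\mathbb{R}^d$ with finite fourth moments, and assume $Q$ has a density with respect to Lebesgue measure. Let $X_1,X_2,\ldots$ be i.i.d. random variables with law $P$, and for $n\ge1$ let $P_n$ be the empirical measure on $X_1,\ldots,X_n$. Then $$\mathrm{Var}\big(\mathcal{W}_2^2(P_n,Q)\big)\le\frac{C(P,Q)}{n},$$ where $$C(P,Q)=8\Big(E\big(\|X_1-X_2\|^2\|X_1\|^2\big)+\big(E\|X_1-X_2\|^4\big)^{1/2}\Big(\int_{\mathbb{R}^d}\|y\|^4\,dQ(y)\Big)^{1/2}\Big).$$
   Context: $\mathcal{W}_2^2(P,Q)$ is the minimum of $\int\|x-y\|^2\,d\pi(x,y)$ over Borel probabilities $\pi$ on $\mathbb{R}^d\times\mathbb{R}^d$ with marginals $P$ and $Q$. The empirical measure is $P_n=\frac1n\sum_{i=1}^n\delta_{X_i}$. *)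

theory Defs
  imports "HOL-Probability.Probability"
begin

definition couplings :: "'a::euclidean_space measure \<Rightarrow> 'a measure \<Rightarrow> ('a \<times> 'a) measure set" where
  "couplings P Q = {\<pi>. prob_space \<pi> \<and> sets \<pi> = sets borel \<and>
     distr \<pi> borel fst = P \<and> distr \<pi> borel snd = Q}"

(* The minimum of the transport cost. It is taken in ennreal, because the cost of a coupling may
   be infinite. For Borel probability measures P and Q it is attained (the cost is continuous and
   nonnegative, and the set of couplings is nonempty and weakly compact), so LEAST denotes it. *)
definition W2_sq :: "'a::euclidean_space measure \<Rightarrow> 'a measure \<Rightarrow> ennreal" where
  "W2_sq P Q =
     (LEAST c. \<exists>\<pi>\<in>couplings P Q. c = (\<integral>\<^sup>+ z. ennreal ((norm (fst z - snd z))\<^sup>2) \<partial>\<pi>))"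

(* The measure (1/n) * (sum of the Dirac masses at x 1, ..., x n); the sample is indexed from 1. *)
definition empirical_measure :: "nat \<Rightarrow> (nat \<Rightarrow> 'a::euclidean_space) \<Rightarrow> 'a measure" where
  "empirical_measure n x =
     measure_of UNIV (sets borel) (\<lambda>A. (\<Sum>i=1..n. emeasure (return borel (x i)) A) / of_nat n)"

lemma sets_empirical_measure [simp]: "sets (empirical_measure n x) = sets borel"
  and space_empirical_measure [simp]: "space (empirical_measure n x) = UNIV"
proof -
  have "sigma_algebra UNIV (sets (borel :: 'a measure))"
    using sets.sigma_algebra_axioms[of "borel :: 'a measure"] by simp
  then show "sets (empirical_measure n x) = sets borel"
    by (simp add: empirical_measure_def sigma_algebra.sets_measure_of_eq
        sigma_algebra.sigma_sets_eq)
  show "space (empirical_measure n x) = UNIV"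
    by (simp add: empirical_measure_def space_measure_of_conv)
qed

(* measure_of yields the null measure when its last argument is not countably additive;
   the next two facts confirm that this does not happen here. *)
lemma emeasure_empirical_measure:
  assumes "A \<in> sets borel"
  shows "emeasure (empirical_measure n x) A =
    (\<Sum>i=1..n. emeasure (return borel (x i)) A) / of_nat n"
proof (rule emeasure_measure_of[OF empirical_measure_def])
  show "positive (sets (empirical_measure n x))
      (\<lambda>A. (\<Sum>i=1..n. emeasure (return borel (x i)) A) / of_nat n)"
    by (simp add: positive_def)
  show "countably_additive (sets (empirical_measure n x))
      (\<lambda>A. (\<Sum>i=1..n. emeasure (return borel (x i)) A) / of_nat n)"
  proof (rule countably_additiveI)
    fix B :: "nat \<Rightarrow> 'a set"
    assume B: "range B \<subseteq> sets (empirical_measure n x)" "disjoint_family B"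
    have "(\<Sum>k. (\<Sum>i=1..n. emeasure (return borel (x i)) (B k)) / of_nat n) =
        (\<Sum>i=1..n. \<Sum>k. emeasure (return borel (x i)) (B k)) / of_nat n"
      by (simp add: divide_ennreal_def suminf_sum)
    also have "\<dots> = (\<Sum>i=1..n. emeasure (return borel (x i)) (\<Union>k. B k)) / of_nat n"
      using B by (subst suminf_emeasure) auto
    finally show "(\<Sum>k. (\<Sum>i=1..n. emeasure (return borel (x i)) (B k)) / of_nat n) =
        (\<Sum>i=1..n. emeasure (return borel (x i)) (\<Union>k. B k)) / of_nat n" .
  qed
qed (use assms in auto)

lemma prob_space_empirical_measure: "n \<ge> 1 \<Longrightarrow> prob_space (empirical_measure n x)"
  by (rule prob_spaceI)
     (simp add: emeasure_empirical_measure ennreal_divide_self ennreal_of_nat_eq_real_of_nat)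

end

theory Submission
  imports Defs
begin

text \<open>
  Let W(x) be the squared Wasserstein distance between Q and the empirical measure on the points
  x 1, ..., x n. The bound has two ingredients: an Efron--Stein inequality, and an estimate of how
  much W can increase when one of the points is moved.

  A transport plan between the empirical measure and Q amounts to cutting Q into n parts of mass
  1/n, the i-th part being carried to x i. The parts are encoded by their densities g i with respect
  to Q; a family of such densities is an allocation. The allocations do not depend on the points
  x i, which enter only through the cost
  \<Sum>i. \<integral> |x i - y|^2 * g i y dQ(y). Hence an allocation that is optimal for x is
  still admissible, though perhaps not optimal, after x i has been replaced by x' i, and W increases by
  at most \<integral> (|x' i - y|^2 - |x i - y|^2) * g i y dQ(y). By the Cauchy--Schwarz inequality
  and since g i has mass 1/n, the squared positive part of the increase is at most
  |x i - x' i|^2 / n * (4 (|x i|^2 + |x' i|^2) / n + 8 \<integral> |y|^2 * g i y dQ(y)).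

  The Efron--Stein inequality bounds the variance by \<Sum>i. E (W(x with x i resampled) - W(x))_+^2.
  Because only increases away from the original sample occur, the same allocation g serves all i at
  once, and everything is estimated for each fixed outcome before expectations are taken: the g i add
  up to 1, so the sum of the squares of the terms \<integral> |y|^2 * g i y dQ(y) is at most
  (1/n) \<integral> |y|^4 dQ(y). Taking expectations, with E sqrt S \<le> sqrt (E S), gives the
  constant of the theorem.

  It remains to see that the minimum defining W is attained. Allocations form a convex set of bounded
  functions on which the cost is affine. Among nearly optimal allocations, those of nearly least
  energy \<Sum>i. \<integral> (g i)^2 dQ form a Cauchy sequence in L2(Q) by the parallelogram law; an
  almost everywhere limit of a subsequence is optimal by dominated convergence.
\<close>

section \<open>Elementary inequalities\<close>

lemma norm_diff_power2_le:
  fixes a b :: "'a::real_normed_vector"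
  shows "(norm (a - b))\<^sup>2 \<le> 2 * (norm a)\<^sup>2 + 2 * (norm b)\<^sup>2"
proof -
  have "(norm (a - b))\<^sup>2 \<le> (norm a + norm b)\<^sup>2"
    by (intro power_mono norm_triangle_ineq4) simp
  also have "\<dots> \<le> 2 * (norm a)\<^sup>2 + 2 * (norm b)\<^sup>2"
    using sum_squares_bound[of "norm a" "norm b"] by (simp add: power2_sum)
  finally show ?thesis .
qed

lemma norm_diff_power4_le:
  fixes a b :: "'a::real_normed_vector"
  shows "norm (a - b) ^ 4 \<le> 8 * norm a ^ 4 + 8 * norm b ^ 4"
proof -
  have "((norm (a - b))\<^sup>2)\<^sup>2 \<le> (2 * (norm a)\<^sup>2 + 2 * (norm b)\<^sup>2)\<^sup>2"
    by (intro power_mono norm_diff_power2_le) simp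
  also have "\<dots> \<le> 8 * ((norm a)\<^sup>2)\<^sup>2 + 8 * ((norm b)\<^sup>2)\<^sup>2"
    using sum_squares_bound[of "(norm a)\<^sup>2" "(norm b)\<^sup>2"] by (simp add: power2_sum power_mult_distrib)
  finally show ?thesis by (simp add: power_mult[symmetric])
qed

lemma norm_power2_diff_le:
  fixes a b y :: "'a::real_inner"
  shows "(norm (a - y))\<^sup>2 - (norm (b - y))\<^sup>2 \<le> norm (a - b) * norm (a + b - 2 *\<^sub>R y)"
proof -
  have "(norm (a - y))\<^sup>2 - (norm (b - y))\<^sup>2 = inner (a - b) (a + b - 2 *\<^sub>R y)"
    by (simp add: power2_norm_eq_inner algebra_simps inner_commute)
  also have "\<dots> \<le> norm (a - b) * norm (a + b - 2 *\<^sub>R y)"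
    by (rule norm_cauchy_schwarz)
  finally show ?thesis .
qed

lemma (in prob_space) expectation_power2_le:
  fixes f :: "'a \<Rightarrow> real"
  assumes "integrable M f" "integrable M (\<lambda>y. (f y)\<^sup>2)"
  shows "(expectation f)\<^sup>2 \<le> expectation (\<lambda>y. (f y)\<^sup>2)"
  using variance_eq[OF assms] variance_positive[of f] by simp

lemma emeasure_distr_nn_integral:
  assumes "f \<in> measurable M N" "A \<in> sets N"
  shows "emeasure (distr M N f) A = (\<integral>\<^sup>+ z. indicator A (f z) \<partial>M)"
proof -
  have "emeasure (distr M N f) A = (\<integral>\<^sup>+ z. indicator A z \<partial>distr M N f)"
    using assms by simp
  also have "\<dots> = (\<integral>\<^sup>+ z. indicator A (f z) \<partial>M)"
    using assms by (intro nn_integral_distr) auto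
  finally show ?thesis .
qed

section \<open>Minimising sequences and almost everywhere convergence\<close>

text \<open>
  A substitute for weak compactness. Here J is the functional to be minimised and E a bounded energy;
  the quantity (E a + E b) / 2 - E (mid a b) is, in the application, a quarter of the squared L2
  distance of a and b. On the set of k-th near-minimisers of J let e k be the infimum of E. These
  sets shrink and are closed under midpoints, so e is increasing and bounded, and two near-minimisers
  whose energies are close to e k have a midpoint of energy at least e k: they must be close to each
  other.
\<close>

lemma midpoint_minimising_sequence:
  fixes J E :: "'s \<Rightarrow> real"
  assumes ne: "K \<noteq> {}"
    and mid: "\<And>a b. a \<in> K \<Longrightarrow> b \<in> K \<Longrightarrow> mid a b \<in> K"
    and J_mid: "\<And>a b. a \<in> K \<Longrightarrow> b \<in> K \<Longrightarrow> J (mid a b) \<le> max (J a) (J b)"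
    and J_bdd: "\<And>a. a \<in> K \<Longrightarrow> c \<le> J a"
    and E_bdd: "\<And>a. a \<in> K \<Longrightarrow> 0 \<le> E a" "\<And>a. a \<in> K \<Longrightarrow> E a \<le> B"
  obtains u where "\<And>k. u k \<in> K" "(\<lambda>k. J (u k)) \<longlonglongrightarrow> Inf (J ` K)"
    "\<And>\<epsilon>. \<epsilon> > 0 \<Longrightarrow> \<exists>N. \<forall>k\<ge>N. \<forall>l\<ge>N. (E (u k) + E (u l)) / 2 - E (mid (u k) (u l)) < \<epsilon>"
proof -
  define m where "m = Inf (J ` K)"
  define L where "L k = {a \<in> K. J a \<le> m + inverse (real (Suc k))}" for k
  define e where "e k = Inf (E ` L k)" for k
  have bddJ: "bdd_below (J ` K)" using J_bdd by (auto intro!: bdd_belowI2)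
  have bddE: "bdd_below (E ` L k)" for k
    using E_bdd by (auto simp: L_def intro!: bdd_belowI2[where m = 0])
  have L_ne: "L k \<noteq> {}" for k
  proof -
    have "Inf (J ` K) < m + inverse (real (Suc k))"
      by (simp add: m_def)
    then obtain a where "a \<in> K" "J a < m + inverse (real (Suc k))"
      using cInf_lessD[of "J ` K"] ne by auto
    then show ?thesis by (auto simp: L_def intro!: exI[of _ a])
  qed
  have L_mono: "L l \<subseteq> L k" if "k \<le> l" for k l
  proof -
    have "inverse (real (Suc l)) \<le> inverse (real (Suc k))"
      using that by (intro le_imp_inverse_le) auto
    then have "m + inverse (real (Suc l)) \<le> m + inverse (real (Suc k))"
      by (rule add_left_mono)
    then show ?thesis unfolding L_def by (blast intro: order_trans)
  qed
  have "\<exists>a\<in>L k. E a < e k + inverse (real (Suc k))" for k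
  proof -
    have "Inf (E ` L k) < e k + inverse (real (Suc k))"
      by (simp add: e_def)
    then show ?thesis
      using cInf_lessD[of "E ` L k"] L_ne by auto
  qed
  then obtain u where u: "\<And>k. u k \<in> L k" "\<And>k. E (u k) < e k + inverse (real (Suc k))"
    by metis
  have uK: "u k \<in> K" for k using u(1)[of k] by (simp add: L_def)
  have "incseq e"
  proof (rule incseq_SucI)
    show "e k \<le> e (Suc k)" for k
      unfolding e_def using L_ne L_mono[of k "Suc k"] bddE by (intro cInf_superset_mono) auto
  qed
  moreover have "e k \<le> B" for k
    using cInf_lower[OF imageI[OF u(1)[of k]] bddE] E_bdd(2)[OF uK[of k]] by (simp add: e_def)
  ultimately have "convergent e"
    using incseq_convergent[of e B] by (metis convergentI)
  then have "Cauchy e" by (rule convergent_Cauchy)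
  have lim: "(\<lambda>k. J (u k)) \<longlonglongrightarrow> m"
  proof (rule tendsto_sandwich)
    show "\<forall>\<^sub>F k in sequentially. m \<le> J (u k)"
      unfolding m_def using bddJ uK by (intro always_eventually allI cInf_lower) auto
    show "\<forall>\<^sub>F k in sequentially. J (u k) \<le> m + inverse (real (Suc k))"
      using u(1) by (auto simp: L_def)
    show "(\<lambda>k. m + inverse (real (Suc k))) \<longlonglongrightarrow> m"
      using tendsto_add[OF tendsto_const LIMSEQ_inverse_real_of_nat] by (metis add_0_right)
  qed simp
  have "\<exists>N. \<forall>k\<ge>N. \<forall>l\<ge>N. (E (u k) + E (u l)) / 2 - E (mid (u k) (u l)) < \<epsilon>" if "\<epsilon> > 0" for \<epsilon>
  proof -
    from \<open>Cauchy e\<close> \<open>\<epsilon> > 0\<close> obtain N1 where N1: "\<And>k l. k \<ge> N1 \<Longrightarrow> l \<ge> N1 \<Longrightarrow> \<bar>e k - e l\<bar> < \<epsilon> / 2"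
      unfolding Cauchy_def dist_real_def by (metis half_gt_zero)
    obtain N2 where N2: "inverse (real (Suc N2)) < \<epsilon> / 2"
      using reals_Archimedean half_gt_zero[OF \<open>\<epsilon> > 0\<close>] by blast
    have small: "inverse (real (Suc j)) < \<epsilon> / 2" if "j \<ge> N2" for j
      by (rule le_less_trans[OF _ N2], rule le_imp_inverse_le) (use that in auto)
    show ?thesis
    proof (intro exI[of _ "max N1 N2"] allI impI)
      fix k l assume kl: "max N1 N2 \<le> k" "max N1 N2 \<le> l"
      define p where "p = min k l"
      have p: "p \<ge> N1" "p \<ge> N2" "u k \<in> L p" "u l \<in> L p"
        using kl u(1) L_mono[of p k] L_mono[of p l] by (auto simp: p_def)
      then have "mid (u k) (u l) \<in> L p"
        using mid[of "u k" "u l"] J_mid[of "u k" "u l"] by (auto simp: L_def)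
      then have "e p \<le> E (mid (u k) (u l))"
        unfolding e_def using bddE by (intro cInf_lower) auto
      moreover have "inverse (real (Suc k)) < \<epsilon> / 2" "inverse (real (Suc l)) < \<epsilon> / 2"
        using small kl by auto
      ultimately show "(E (u k) + E (u l)) / 2 - E (mid (u k) (u l)) < \<epsilon>"
        using u(2)[of k] u(2)[of l] N1[of k p] N1[of l p] kl p
        unfolding add_divide_distrib abs_less_iff by linarith
    qed
  qed
  with uK lim show ?thesis using that[of u] unfolding m_def by blast
qed

text \<open>
  Finitely many Cauchy sequences in L1 share one almost everywhere convergent subsequence, since a
  further subsequence can be extracted for each of them in turn.
\<close>

lemma cauchy_L1_AE_cauchy_subseq_finite:
  fixes s :: "nat \<Rightarrow> 'i \<Rightarrow> 'a \<Rightarrow> real"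
  assumes fin: "finite I"
    and int: "\<And>i k. i \<in> I \<Longrightarrow> integrable M (s k i)"
    and cauchy: "\<And>i e. i \<in> I \<Longrightarrow> e > 0 \<Longrightarrow> \<exists>N. \<forall>k\<ge>N. \<forall>l\<ge>N. (LINT x|M. norm (s k i x - s l i x)) < e"
  obtains r :: "nat \<Rightarrow> nat" where "strict_mono r" "\<And>i. i \<in> I \<Longrightarrow> AE x in M. Cauchy (\<lambda>k. s (r k) i x)"
proof -
  from fin int cauchy have "\<exists>r :: nat \<Rightarrow> nat. strict_mono r \<and> (\<forall>i\<in>I. AE x in M. Cauchy (\<lambda>k. s (r k) i x))"
  proof (induction I)
    case empty
    show ?case by (auto intro!: exI[of _ id] simp: strict_mono_def)
  next
    case (insert i I)
    then obtain r where r: "strict_mono r" "\<And>j. j \<in> I \<Longrightarrow> AE x in M. Cauchy (\<lambda>k. s (r k) j x)"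
      by auto
    have "\<exists>N. \<forall>k\<ge>N. \<forall>l\<ge>N. (LINT x|M. norm (s (r k) i x - s (r l) i x)) < e" if "e > 0" for e
      using insert.prems(2)[of i e] that seq_suble[OF r(1)] by (meson insertI1 order_trans)
    with insert.prems(1) obtain r' where r': "strict_mono r'" "AE x in M. Cauchy (\<lambda>k. s (r (r' k)) i x)"
      using cauchy_L1_AE_cauchy_subseq[of M "\<lambda>k. s (r k) i"] by blast
    have "AE x in M. Cauchy (\<lambda>k. s ((r \<circ> r') k) j x)" if "j \<in> I" for j
      using r(2)[OF that] by eventually_elim (use r'(1) Cauchy_subseq_Cauchy in \<open>force simp: comp_def\<close>)
    then have "\<forall>j\<in>insert i I. AE x in M. Cauchy (\<lambda>k. s ((r \<circ> r') k) j x)"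
      using r'(2) by auto
    then show ?case using strict_mono_o[OF r(1) r'(1)] by blast
  qed
  then show ?thesis using that by blast
qed

section \<open>Couplings of an empirical measure as allocations\<close>

text \<open>
  The conditions are imposed Q-almost everywhere because the densities come from the Radon--Nikodym
  theorem and from almost everywhere limits.
\<close>

definition allocations :: "'a::euclidean_space measure \<Rightarrow> nat \<Rightarrow> (nat \<Rightarrow> 'a \<Rightarrow> real) set" where
  "allocations Q n = {g.
     (\<forall>i\<in>{1..n}. g i \<in> borel_measurable borel \<and> (AE y in Q. 0 \<le> g i y) \<and> (\<integral>y. g i y \<partial>Q) = 1 / real n)
     \<and> (AE y in Q. (\<Sum>i=1..n. g i y) = 1)}"

definition allocation_cost ::
  "'a::euclidean_space measure \<Rightarrow> nat \<Rightarrow> (nat \<Rightarrow> 'a) \<Rightarrow> (nat \<Rightarrow> 'a \<Rightarrow> real) \<Rightarrow> real" where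
  "allocation_cost Q n x g = (\<Sum>i=1..n. \<integral>y. (norm (x i - y))\<^sup>2 * g i y \<partial>Q)"

text \<open>
  Under \<pi>, mass is placed at (x i, y) with density g i y. Testing against nonnegative functions h
  yields both marginals (h an indicator of one coordinate) and the cost (h the squared distance).
\<close>

definition represents ::
  "'a::euclidean_space measure \<Rightarrow> nat \<Rightarrow> (nat \<Rightarrow> 'a) \<Rightarrow> (nat \<Rightarrow> 'a \<Rightarrow> real) \<Rightarrow> ('a \<times> 'a) measure \<Rightarrow> bool" where
  "represents Q n x g \<pi> \<longleftrightarrow> (\<forall>h\<in>borel_measurable borel.
     (\<integral>\<^sup>+ z. h z \<partial>\<pi>) = (\<Sum>i=1..n. \<integral>\<^sup>+ y. h (x i, y) * ennreal (g i y) \<partial>Q))"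

locale target_measure = prob_space Q for Q :: "'a::euclidean_space measure" +
  assumes sets_Q [measurable_cong]: "sets Q = sets borel"
begin

lemma space_Q [simp]: "space Q = UNIV"
  using sets_eq_imp_space_eq[OF sets_Q] by simp

lemma allocationsD:
  assumes "g \<in> allocations Q n"
  shows "\<And>i. i \<in> {1..n} \<Longrightarrow> g i \<in> borel_measurable borel"
    and "\<And>i. i \<in> {1..n} \<Longrightarrow> AE y in Q. 0 \<le> g i y"
    and "\<And>i. i \<in> {1..n} \<Longrightarrow> (\<integral>y. g i y \<partial>Q) = 1 / real n"
    and "AE y in Q. (\<Sum>i=1..n. g i y) = 1"
  using assms by (auto simp: allocations_def)

lemma allocation_AE:
  assumes "g \<in> allocations Q n"
  shows "AE y in Q. (\<forall>i\<in>{1..n}. 0 \<le> g i y \<and> g i y \<le> 1) \<and> (\<Sum>i=1..n. g i y) = 1"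
proof -
  have "AE y in Q. \<forall>i\<in>{1..n}. 0 \<le> g i y"
    using allocationsD(2)[OF assms] by (intro AE_finite_allI) auto
  with allocationsD(4)[OF assms] show ?thesis
  proof eventually_elim
    case (elim y)
    have "g i y \<le> 1" if "i \<in> {1..n}" for i
      using member_le_sum[of i "{1..n}" "\<lambda>i. g i y"] elim that by auto
    with elim show ?case by auto
  qed
qed

lemma integrable_mult_allocation:
  fixes h :: "'a \<Rightarrow> real"
  assumes g: "g \<in> allocations Q n" and i: "i \<in> {1..n}" and h: "integrable Q h"
  shows "integrable Q (\<lambda>y. h y * g i y)"
proof (rule Bochner_Integration.integrable_bound[OF h])
  note [measurable] = allocationsD(1)[OF g i]
  show "(\<lambda>y. h y * g i y) \<in> borel_measurable Q"
    using h by measurable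
  show "AE y in Q. norm (h y * g i y) \<le> norm (h y)"
    using allocation_AE[OF g]
  proof eventually_elim
    case (elim y)
    then have "\<bar>g i y\<bar> \<le> 1" using i by auto
    then show ?case by (simp add: abs_mult mult_left_le)
  qed
qed

lemma integrable_allocation:
  "g \<in> allocations Q n \<Longrightarrow> i \<in> {1..n} \<Longrightarrow> integrable Q (g i)"
  using integrable_mult_allocation[of g n i "\<lambda>_. 1"] by simp

lemma sum_integral_allocation:
  assumes g: "g \<in> allocations Q n" and h: "integrable Q h"
  shows "(\<Sum>i=1..n. \<integral>y. h y * g i y \<partial>Q) = (\<integral>y. h y \<partial>Q)"
proof -
  have "(\<Sum>i=1..n. \<integral>y. h y * g i y \<partial>Q) = (\<integral>y. (\<Sum>i=1..n. h y * g i y) \<partial>Q)"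
    using integrable_mult_allocation[OF g _ h] by (intro Bochner_Integration.integral_sum[symmetric]) auto
  also have "\<dots> = (\<integral>y. h y \<partial>Q)"
  proof (rule integral_cong_AE)
    show "AE y in Q. (\<Sum>i=1..n. h y * g i y) = h y"
      using allocationsD(4)[OF g] by eventually_elim (simp add: sum_distrib_left[symmetric])
    show "(\<lambda>y. \<Sum>i=1..n. h y * g i y) \<in> borel_measurable Q"
      using integrable_mult_allocation[OF g _ h] by (intro borel_measurable_sum) auto
  qed (use h in auto)
  finally show ?thesis .
qed

lemma uniform_allocation:
  assumes "n \<ge> 1"
  shows "(\<lambda>i y. 1 / real n) \<in> allocations Q n"
  using assms prob_space by (auto simp: allocations_def)

lemma nn_integral_allocation:
  assumes "g \<in> allocations Q n" "i \<in> {1..n}"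
  shows "(\<integral>\<^sup>+ y. ennreal (g i y) \<partial>Q) = ennreal (1 / real n)"
  using allocationsD(2,3)[OF assms] integrable_allocation[OF assms]
  by (simp add: nn_integral_eq_integral)

lemma allocation_cost_nonneg:
  assumes "g \<in> allocations Q n"
  shows "0 \<le> allocation_cost Q n x g"
  unfolding allocation_cost_def
proof (intro sum_nonneg integral_nonneg_AE)
  fix i assume "i \<in> {1..n}"
  from allocationsD(2)[OF assms this] show "AE y in Q. 0 \<le> (norm (x i - y))\<^sup>2 * g i y"
    by eventually_elim simp
qed

text \<open>
  The coupling is the law of (x i, y) when the pair (i, y) has density g i y with respect to the
  product of the counting measure on the labels and Q.
\<close>

lemma coupling_of_allocation:
  assumes g: "g \<in> allocations Q n" and n: "n \<ge> 1"
  obtains \<pi> where "\<pi> \<in> couplings (empirical_measure n x) Q" "represents Q n x g \<pi>"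
proof -
  let ?C = "count_space {1..n}"
  let ?w = "\<lambda>(i, y). ennreal (g i y)" and ?p = "\<lambda>(i, y). (x i, y)"
  define \<pi> where "\<pi> = distr (density (?C \<Otimes>\<^sub>M Q) ?w) borel ?p"
  have w: "?w \<in> borel_measurable (?C \<Otimes>\<^sub>M Q)"
    using allocationsD(1)[OF g] by (intro measurable_pair_measure_countable1) auto
  have p: "?p \<in> measurable (?C \<Otimes>\<^sub>M Q) borel"
    by (intro measurable_pair_measure_countable1) (auto simp: borel_prod[symmetric])
  have rep: "represents Q n x g \<pi>"
    unfolding represents_def
  proof
    fix h :: "'a \<times> 'a \<Rightarrow> ennreal" assume h: "h \<in> borel_measurable borel"
    have hp: "(\<lambda>z. h (?p z)) \<in> borel_measurable (?C \<Otimes>\<^sub>M Q)"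
      by (rule measurable_compose[OF p h])
    have "(\<integral>\<^sup>+ z. h z \<partial>\<pi>) = (\<integral>\<^sup>+ z. h (?p z) \<partial>density (?C \<Otimes>\<^sub>M Q) ?w)"
      unfolding \<pi>_def using p h by (intro nn_integral_distr) auto
    also have "\<dots> = (\<integral>\<^sup>+ z. ?w z * h (?p z) \<partial>(?C \<Otimes>\<^sub>M Q))"
      by (rule nn_integral_density[OF w hp])
    also have "\<dots> = (\<integral>\<^sup>+ i. \<integral>\<^sup>+ y. ?w (i, y) * h (?p (i, y)) \<partial>Q \<partial>?C)"
      using borel_measurable_times_ennreal[OF w hp] by (intro nn_integral_fst[symmetric])
    also have "\<dots> = (\<Sum>i=1..n. \<integral>\<^sup>+ y. h (x i, y) * ennreal (g i y) \<partial>Q)"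
      by (simp add: nn_integral_count_space_finite mult.commute)
    finally show "(\<integral>\<^sup>+ z. h z \<partial>\<pi>) = (\<Sum>i=1..n. \<integral>\<^sup>+ y. h (x i, y) * ennreal (g i y) \<partial>Q)" .
  qed
  have sets_\<pi> [measurable_cong]: "sets \<pi> = sets borel" by (simp add: \<pi>_def)
  have rep': "(\<integral>\<^sup>+ z. h z \<partial>\<pi>) = (\<Sum>i=1..n. \<integral>\<^sup>+ y. h (x i, y) * ennreal (g i y) \<partial>Q)"
    if "h \<in> borel_measurable borel" for h
    using rep that by (simp add: represents_def)
  have fst_snd [measurable]: "fst \<in> measurable \<pi> borel" "snd \<in> measurable \<pi> borel"
    by (simp_all add: measurable_cong_sets[OF sets_\<pi> refl] borel_prod[symmetric])
  have marg1: "distr \<pi> borel fst = empirical_measure n x"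
  proof (rule measure_eqI)
    fix A :: "'a set" assume "A \<in> sets (distr \<pi> borel fst)"
    then have A [measurable]: "A \<in> sets borel" by simp
    have "emeasure (distr \<pi> borel fst) A = (\<integral>\<^sup>+ z. indicator A (fst z) \<partial>\<pi>)"
      by (simp add: emeasure_distr_nn_integral)
    also have "\<dots> = (\<Sum>i=1..n. \<integral>\<^sup>+ y. indicator A (x i) * ennreal (g i y) \<partial>Q)"
      by (subst rep') (auto simp: borel_prod[symmetric])
    also have "\<dots> = (\<Sum>i=1..n. indicator A (x i) * ennreal (1 / real n))"
    proof (rule sum.cong[OF refl])
      fix i assume i: "i \<in> {1..n}"
      note [measurable] = allocationsD(1)[OF g i]
      show "(\<integral>\<^sup>+ y. indicator A (x i) * ennreal (g i y) \<partial>Q) = indicator A (x i) * ennreal (1 / real n)"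
        by (subst nn_integral_cmult) (auto simp: nn_integral_allocation[OF g i])
    qed
    also have "\<dots> = emeasure (empirical_measure n x) A"
      using n by (simp add: emeasure_empirical_measure sum_distrib_right[symmetric] divide_ennreal_def
          ennreal_of_nat_eq_real_of_nat inverse_ennreal divide_inverse)
    finally show "emeasure (distr \<pi> borel fst) A = emeasure (empirical_measure n x) A" .
  qed simp
  have marg2: "distr \<pi> borel snd = Q"
  proof (rule measure_eqI)
    fix A :: "'a set" assume "A \<in> sets (distr \<pi> borel snd)"
    then have A [measurable]: "A \<in> sets borel" by simp
    have "emeasure (distr \<pi> borel snd) A = (\<integral>\<^sup>+ z. indicator A (snd z) \<partial>\<pi>)"
      by (simp add: emeasure_distr_nn_integral)
    also have "\<dots> = (\<Sum>i=1..n. \<integral>\<^sup>+ y. indicator A y * ennreal (g i y) \<partial>Q)"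
      by (subst rep') (auto simp: borel_prod[symmetric])
    also have "\<dots> = (\<integral>\<^sup>+ y. (\<Sum>i=1..n. indicator A y * ennreal (g i y)) \<partial>Q)"
      using allocationsD(1)[OF g]
      by (intro nn_integral_sum[symmetric] borel_measurable_times_ennreal measurable_compose[OF _ measurable_ennreal]) auto
    also have "\<dots> = (\<integral>\<^sup>+ y. indicator A y \<partial>Q)"
    proof (rule nn_integral_cong_AE)
      show "AE y in Q. (\<Sum>i=1..n. indicator A y * ennreal (g i y)) = indicator A y"
        using allocation_AE[OF g]
      proof eventually_elim
        case (elim y)
        then have "(\<Sum>i=1..n. ennreal (g i y)) = 1"
          by (subst sum_ennreal) auto
        then show ?case by (simp add: sum_distrib_left[symmetric])
      qed
    qed
    also have "\<dots> = emeasure Q A" by simp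
    finally show "emeasure (distr \<pi> borel snd) A = emeasure Q A" .
  qed (simp add: sets_Q)
  have "prob_space \<pi>"
  proof -
    have "prob_space (distr \<pi> borel snd)" unfolding marg2 by unfold_locales
    then show ?thesis by (rule prob_space_distrD[OF fst_snd(2)])
  qed
  then have "\<pi> \<in> couplings (empirical_measure n x) Q"
    by (simp add: couplings_def marg1 marg2 sets_\<pi>)
  then show ?thesis using rep that by blast
qed

text \<open>
  The part of \<pi> over the point x i is dominated by its second marginal Q, so its second projection
  has a density. When several labels carry the same point, they share this part equally: k i counts
  the labels at x i.
\<close>

lemma allocation_of_coupling:
  assumes \<pi>: "\<pi> \<in> couplings (empirical_measure n x) Q" and n: "n \<ge> 1"
  obtains g where "g \<in> allocations Q n" "represents Q n x g \<pi>"
proof -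
  from \<pi> have sets_\<pi> [measurable_cong]: "sets \<pi> = sets borel"
    and marg1: "distr \<pi> borel fst = empirical_measure n x" and marg2: "distr \<pi> borel snd = Q"
    by (auto simp: couplings_def)
  have space_\<pi> [simp]: "space \<pi> = UNIV"
    using sets_eq_imp_space_eq[OF sets_\<pi>] by simp
  have fst_snd [measurable]: "fst \<in> measurable \<pi> borel" "snd \<in> measurable \<pi> borel"
    by (simp_all add: measurable_cong_sets[OF sets_\<pi> refl] borel_prod[symmetric])
  define k where "k i = card {j\<in>{1..n}. x j = x i}" for i
  have k_pos: "k i > 0" if "i \<in> {1..n}" for i
    using that by (auto simp: k_def card_gt_0_iff)
  \<comment> \<open>Mass of \<pi> at z that is attributed to label i; each label at a point of multiplicity k i
    receives the fraction 1 / k i.\<close>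
  define w where "w i z = (indicator {x i} (fst z) / ennreal (real (k i)) :: ennreal)" for i and z :: "'a \<times> 'a"
  have w [measurable]: "w i \<in> borel_measurable \<pi>" for i
    unfolding w_def by measurable
  define \<nu> where "\<nu> i = distr (density \<pi> (w i)) borel snd" for i
  define g where "g i y = enn2real (RN_deriv Q (\<nu> i) y)" for i y
  have \<nu>_nn: "(\<integral>\<^sup>+ y. h y \<partial>\<nu> i) = (\<integral>\<^sup>+ z. w i z * h (snd z) \<partial>\<pi>)" if "h \<in> borel_measurable borel" for h i
    unfolding \<nu>_def using that
    by (subst nn_integral_distr) (auto simp: nn_integral_density)
  have sets_\<nu>: "sets (\<nu> i) = sets Q" for i
    by (simp add: \<nu>_def sets_Q)
  have w_le: "w i z \<le> 1" if "i \<in> {1..n}" for i z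
  proof -
    have "1 / ennreal (real (k i)) \<le> 1"
      using k_pos[OF that] divide_ennreal[of 1 "real (k i)"] by (simp add: ennreal_le_1)
    then show ?thesis by (simp add: w_def indicator_def)
  qed
  have \<nu>_total: "(\<integral>\<^sup>+ z. w i z \<partial>\<pi>) = ennreal (1 / real n)" if i: "i \<in> {1..n}" for i
  proof -
    have "(\<integral>\<^sup>+ z. w i z \<partial>\<pi>) = (\<integral>\<^sup>+ z. indicator {x i} (fst z) \<partial>\<pi>) / ennreal (real (k i))"
      unfolding w_def by (simp add: nn_integral_divide)
    also have "(\<integral>\<^sup>+ z. indicator {x i} (fst z) \<partial>\<pi>) = emeasure (distr \<pi> borel fst) {x i}"
      by (simp add: emeasure_distr_nn_integral)
    also have "\<dots> = (\<Sum>j=1..n. indicator {x i} (x j)) / of_nat n"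
      unfolding marg1 by (simp add: emeasure_empirical_measure)
    also have "(\<Sum>j=1..n. indicator {x i} (x j)) = (of_nat (k i) :: ennreal)"
      unfolding k_def by (simp add: indicator_def sum.If_cases Int_def)
    finally show ?thesis
      using k_pos[OF i] n
      by (simp add: ennreal_of_nat_eq_real_of_nat divide_ennreal)
  qed
  have ac: "absolutely_continuous Q (\<nu> i)" if i: "i \<in> {1..n}" for i
    unfolding absolutely_continuous_def
  proof
    fix B assume "B \<in> null_sets Q"
    then have B [measurable]: "B \<in> sets borel" and B0: "emeasure Q B = 0"
      by (auto simp: sets_Q)
    have "emeasure (\<nu> i) B = (\<integral>\<^sup>+ z. w i z * indicator B (snd z) \<partial>\<pi>)"
      by (subst \<nu>_nn[symmetric]) (auto simp: sets_\<nu> sets_Q)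
    also have "\<dots> \<le> (\<integral>\<^sup>+ z. indicator B (snd z) \<partial>\<pi>)"
      using w_le[OF i] by (intro nn_integral_mono) (auto simp: indicator_def)
    also have "\<dots> = emeasure (distr \<pi> borel snd) B"
      by (simp add: emeasure_distr_nn_integral)
    finally show "B \<in> null_sets (\<nu> i)"
      using B0 by (auto simp: marg2 sets_\<nu> sets_Q)
  qed
  have fin: "AE y in Q. ennreal (g i y) = RN_deriv Q (\<nu> i) y" if i: "i \<in> {1..n}" for i
  proof -
    have "emeasure (\<nu> i) (space (\<nu> i)) = ennreal (1 / real n)"
      using \<nu>_nn[of "\<lambda>_. 1" i] \<nu>_total[OF i] by simp
    then have "finite_measure (\<nu> i)"
      by (intro finite_measureI) auto
    then have "sigma_finite_measure (\<nu> i)"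
      by (simp add: finite_measure_def)
    from RN_deriv_finite[OF this ac[OF i] sets_\<nu>] show ?thesis
      by eventually_elim (simp add: g_def less_top)
  qed
  have g_m: "g i \<in> borel_measurable borel" for i
  proof -
    have "RN_deriv Q (\<nu> i) \<in> borel_measurable borel"
      using borel_measurable_RN_deriv[of Q "\<nu> i"] by (simp add: measurable_cong_sets[OF sets_Q refl])
    then show ?thesis unfolding g_def by measurable
  qed
  have slice: "(\<integral>\<^sup>+ y. h y * ennreal (g i y) \<partial>Q) = (\<integral>\<^sup>+ z. w i z * h (snd z) \<partial>\<pi>)"
    if i: "i \<in> {1..n}" and h: "h \<in> borel_measurable borel" for i h
  proof -
    have "(\<integral>\<^sup>+ y. h y * ennreal (g i y) \<partial>Q) = (\<integral>\<^sup>+ y. RN_deriv Q (\<nu> i) y * h y \<partial>Q)"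
      using fin[OF i] by (intro nn_integral_cong_AE) (auto simp: mult.commute)
    also have "\<dots> = (\<integral>\<^sup>+ y. h y \<partial>\<nu> i)"
      using h by (intro RN_deriv_nn_integral[symmetric] ac[OF i] sets_\<nu>) (simp add: measurable_cong_sets[OF sets_Q refl])
    finally show ?thesis using \<nu>_nn[OF h] by simp
  qed
  have atoms: "AE z in \<pi>. fst z \<in> x ` {1..n}"
  proof -
    have "AE a in distr \<pi> borel fst. a \<in> x ` {1..n}"
      unfolding marg1
    proof (rule AE_I)
      have "- (x ` {1..n}) \<in> sets borel"
        by (intro borel_open open_Compl finite_imp_closed) auto
      then show "emeasure (empirical_measure n x) (- (x ` {1..n})) = 0"
        by (subst emeasure_empirical_measure) (auto intro!: sum.neutral)
      show "- (x ` {1..n}) \<in> sets (empirical_measure n x)"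
        by (simp, intro borel_open open_Compl finite_imp_closed) auto
    qed auto
    then show ?thesis
      by (subst (asm) AE_distr_iff) (auto intro!: borel_closed finite_imp_closed)
  qed
  \<comment> \<open>The k i labels sitting at the first coordinate of z together receive the full mass of z.\<close>
  have weights: "AE z in \<pi>. (\<Sum>i=1..n. w i z * h (x i, snd z)) = h z" for h :: "'a \<times> 'a \<Rightarrow> ennreal"
    using atoms
  proof eventually_elim
    case (elim z)
    then obtain l where l: "l \<in> {1..n}" "fst z = x l" by auto
    have "(\<Sum>i=1..n. w i z * h (x i, snd z)) = (\<Sum>i\<in>{j\<in>{1..n}. x j = x l}. w i z * h (x i, snd z))"
      by (rule sum.mono_neutral_right) (auto simp: w_def indicator_def l)
    also have "\<dots> = (\<Sum>i\<in>{j\<in>{1..n}. x j = x l}. h z / ennreal (real (k l)))"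
      by (rule sum.cong) (auto simp: w_def l k_def divide_ennreal_def mult.commute prod_eq_iff
          intro!: arg_cong2[of _ _ _ _ "(*)"] arg_cong[of _ _ h])
    also have "\<dots> = of_nat (k l) * (h z / ennreal (real (k l)))"
      by (simp add: k_def)
    also have "\<dots> = h z"
      using k_pos[OF l(1)] by (simp add: ennreal_of_nat_eq_real_of_nat ennreal_times_divide mult_divide_eq_ennreal mult.commute[of "ennreal _"])
    finally show ?case .
  qed
  have rep: "represents Q n x g \<pi>"
    unfolding represents_def
  proof
    fix h :: "'a \<times> 'a \<Rightarrow> ennreal" assume h [measurable]: "h \<in> borel_measurable borel"
    have hs: "(\<lambda>y. h (a, y)) \<in> borel_measurable borel" for a
      by (rule measurable_compose[OF _ h]) (simp add: borel_prod[symmetric])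
    have "(\<Sum>i=1..n. \<integral>\<^sup>+ y. h (x i, y) * ennreal (g i y) \<partial>Q) = (\<Sum>i=1..n. \<integral>\<^sup>+ z. w i z * h (x i, snd z) \<partial>\<pi>)"
      using slice[OF _ hs] by (intro sum.cong) auto
    also have "\<dots> = (\<integral>\<^sup>+ z. (\<Sum>i=1..n. w i z * h (x i, snd z)) \<partial>\<pi>)"
      using measurable_compose[OF fst_snd(2) hs]
      by (intro nn_integral_sum[symmetric] borel_measurable_times_ennreal w) auto
    also have "\<dots> = (\<integral>\<^sup>+ z. h z \<partial>\<pi>)"
      by (rule nn_integral_cong_AE) (rule weights)
    finally show "(\<integral>\<^sup>+ z. h z \<partial>\<pi>) = (\<Sum>i=1..n. \<integral>\<^sup>+ y. h (x i, y) * ennreal (g i y) \<partial>Q)" ..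
  qed
  have "(\<integral>y. g i y \<partial>Q) = 1 / real n" if i: "i \<in> {1..n}" for i
  proof -
    have "(\<integral>\<^sup>+ y. ennreal (g i y) \<partial>Q) = ennreal (1 / real n)"
      using slice[OF i, of "\<lambda>_. 1"] \<nu>_total[OF i] by simp
    moreover have "0 \<le> g i y" for y by (simp add: g_def)
    ultimately show ?thesis
      using g_m[of i] by (subst integral_eq_nn_integral) (auto simp: measurable_cong_sets[OF sets_Q refl])
  qed
  moreover have "AE y in Q. (\<Sum>i=1..n. g i y) = 1"
  proof -
    let ?s = "\<lambda>y. \<Sum>i=1..n. ennreal (g i y)"
    have s: "?s \<in> borel_measurable Q"
      using g_m by (simp add: measurable_cong_sets[OF sets_Q refl])
    \<comment> \<open>Both sides are Q: the parts of \<pi> over the individual points add up to its second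
      marginal.\<close>
    have "density Q ?s = density Q (\<lambda>_. 1)"
    proof (rule measure_eqI)
      fix B assume "B \<in> sets (density Q ?s)"
      then have B [measurable]: "B \<in> sets borel" by (simp add: sets_Q)
      have m: "(\<lambda>z. indicator B (snd z)) \<in> borel_measurable (borel :: ('a \<times> 'a) measure)"
        by (simp add: borel_prod[symmetric])
      have "emeasure (density Q ?s) B = (\<integral>\<^sup>+ y. (\<Sum>i=1..n. indicator B y * ennreal (g i y)) \<partial>Q)"
        using s B sets_Q by (subst emeasure_density) (simp_all only: sum_distrib_left mult.commute[of _ "indicator B _"])
      also have "\<dots> = (\<Sum>i=1..n. \<integral>\<^sup>+ y. indicator B y * ennreal (g i y) \<partial>Q)"
        using g_m sets_Q by (intro nn_integral_sum) auto
      also have "\<dots> = (\<integral>\<^sup>+ z. indicator B (snd z) \<partial>\<pi>)"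
        using rep m unfolding represents_def by auto
      also have "\<dots> = emeasure (distr \<pi> borel snd) B"
        by (simp add: emeasure_distr_nn_integral)
      also have "\<dots> = emeasure (density Q (\<lambda>_. 1)) B"
        unfolding marg2 by (simp add: density_1)
      finally show "emeasure (density Q ?s) B = emeasure (density Q (\<lambda>_. 1)) B" .
    qed simp
    then have "AE y in Q. ?s y = 1"
      using density_unique_iff[OF s, of "\<lambda>_. 1"] by simp
    then show ?thesis
      by eventually_elim (simp add: g_def sum_ennreal ennreal_eq_1)
  qed
  moreover have "AE y in Q. 0 \<le> g i y" for i
    by (simp add: g_def)
  ultimately have "g \<in> allocations Q n"
    using g_m by (auto simp: allocations_def)
  then show ?thesis using rep that by blast
qed

section \<open>Existence of an optimal allocation\<close>

lemma integrable_norm_diff_power2: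
  assumes "integrable Q (\<lambda>y. (norm y)\<^sup>2)"
  shows "integrable Q (\<lambda>y. (norm (a - y))\<^sup>2)"
proof (rule Bochner_Integration.integrable_bound)
  show "integrable Q (\<lambda>y. 2 * (norm a)\<^sup>2 + 2 * (norm y)\<^sup>2)"
    using assms by simp
  have "(norm (a - y))\<^sup>2 \<le> 2 * (norm a)\<^sup>2 + 2 * (norm y)\<^sup>2" for y
    using norm_diff_power2_le by blast
  then show "AE y in Q. norm ((norm (a - y))\<^sup>2) \<le> norm (2 * (norm a)\<^sup>2 + 2 * (norm y)\<^sup>2)"
    by simp
qed measurable

text \<open>
  The sequence supplied by the midpoint lemma is Cauchy in L2(Q), hence in L1(Q) because Q is a
  probability measure. All its members lie between 0 and 1 almost everywhere, so integrals against a
  fixed integrable function, in particular the squared distance to x i, pass to the limit.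
\<close>

lemma optimal_allocation_exists:
  assumes n: "n \<ge> 1" and sq: "integrable Q (\<lambda>y. (norm y)\<^sup>2)"
  obtains g where "g \<in> allocations Q n"
    "\<And>h. h \<in> allocations Q n \<Longrightarrow> allocation_cost Q n x g \<le> allocation_cost Q n x h"
proof -
  let ?J = "allocation_cost Q n x"
  define E where "E g = (\<Sum>i=1..n. \<integral>y. (g i y)\<^sup>2 \<partial>Q)" for g :: "nat \<Rightarrow> 'a \<Rightarrow> real"
  define mid where "mid a b = (\<lambda>i y. (a i y + b i y) / 2)" for a b :: "nat \<Rightarrow> 'a \<Rightarrow> real"
  let ?K = "allocations Q n"
  note int_g = integrable_allocation
  have int_c: "integrable Q (\<lambda>y. (norm (x i - y))\<^sup>2)" for i
    by (rule integrable_norm_diff_power2[OF sq])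
  note int_cg = integrable_mult_allocation[OF _ _ int_c]
  have int_prod: "integrable Q (\<lambda>y. a i y * b i y)" if "a \<in> ?K" "b \<in> ?K" "i \<in> {1..n}" for a b i
    using integrable_mult_allocation[OF that(2,3) int_g[OF that(1,3)]] .
  have mid_in: "mid a b \<in> ?K" if "a \<in> ?K" "b \<in> ?K" for a b
  proof -
    have "AE y in Q. 0 \<le> mid a b i y" if "i \<in> {1..n}" for i
      using allocationsD(2)[OF \<open>a \<in> ?K\<close> that] allocationsD(2)[OF \<open>b \<in> ?K\<close> that]
      by eventually_elim (simp add: mid_def)
    moreover have "AE y in Q. (\<Sum>i=1..n. mid a b i y) = 1"
      using allocationsD(4)[OF that(1)] allocationsD(4)[OF that(2)]
      by eventually_elim (simp add: mid_def sum_divide_distrib[symmetric] sum.distrib)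
    ultimately show ?thesis
      using that allocationsD(1,3)[OF that(1)] allocationsD(1,3)[OF that(2)] int_g[OF that(1)] int_g[OF that(2)]
      by (auto simp: allocations_def mid_def[abs_def])
  qed
  have J_mid: "?J (mid a b) = (?J a + ?J b) / 2" if "a \<in> ?K" "b \<in> ?K" for a b
  proof -
    have "(\<integral>y. (norm (x i - y))\<^sup>2 * mid a b i y \<partial>Q)
        = ((\<integral>y. (norm (x i - y))\<^sup>2 * a i y \<partial>Q) + (\<integral>y. (norm (x i - y))\<^sup>2 * b i y \<partial>Q)) / 2" if "i \<in> {1..n}" for i
      using int_cg[OF \<open>a \<in> ?K\<close> that, of i] int_cg[OF \<open>b \<in> ?K\<close> that, of i]
      by (simp add: mid_def distrib_left add_divide_distrib)
    then have "?J (mid a b) = (\<Sum>i=1..n. ((\<integral>y. (norm (x i - y))\<^sup>2 * a i y \<partial>Q) + (\<integral>y. (norm (x i - y))\<^sup>2 * b i y \<partial>Q)) / 2)"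
      unfolding allocation_cost_def by (intro sum.cong) auto
    then show ?thesis
      by (simp only: allocation_cost_def sum.distrib sum_divide_distrib[symmetric])
  qed
  note J_nonneg = allocation_cost_nonneg[where x = x]
  have E_nonneg: "0 \<le> E a" for a unfolding E_def by (intro sum_nonneg integral_nonneg) auto
  have E_le: "E a \<le> real n" if "a \<in> ?K" for a
  proof -
    have "(\<integral>y. (a i y)\<^sup>2 \<partial>Q) \<le> (\<integral>y. 1 \<partial>Q)" if i: "i \<in> {1..n}" for i
    proof (rule integral_mono_AE)
      show "integrable Q (\<lambda>y. (a i y)\<^sup>2)"
        using int_prod[OF \<open>a \<in> ?K\<close> \<open>a \<in> ?K\<close> i] by (simp add: power2_eq_square)
      show "AE y in Q. (a i y)\<^sup>2 \<le> 1"
        using allocation_AE[OF \<open>a \<in> ?K\<close>]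
        by eventually_elim (use i in \<open>auto intro!: power_le_one\<close>)
    qed simp
    then have "E a \<le> (\<Sum>i=1..n. 1)"
      unfolding E_def using prob_space by (intro sum_mono) simp
    then show ?thesis by simp
  qed
  have E_mid: "(E a + E b) / 2 - E (mid a b) = (\<Sum>i=1..n. \<integral>y. (a i y - b i y)\<^sup>2 \<partial>Q) / 4"
    if "a \<in> ?K" "b \<in> ?K" for a b
  proof -
    have "((\<integral>y. (a i y)\<^sup>2 \<partial>Q) + (\<integral>y. (b i y)\<^sup>2 \<partial>Q)) / 2 - (\<integral>y. (mid a b i y)\<^sup>2 \<partial>Q)
        = (\<integral>y. (a i y - b i y)\<^sup>2 \<partial>Q) / 4" if i: "i \<in> {1..n}" for i
    proof -
      note ip = int_prod[OF \<open>a \<in> ?K\<close> \<open>a \<in> ?K\<close> i] int_prod[OF \<open>b \<in> ?K\<close> \<open>b \<in> ?K\<close> i] int_prod[OF \<open>a \<in> ?K\<close> \<open>b \<in> ?K\<close> i]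
      have "(\<integral>y. (mid a b i y)\<^sup>2 \<partial>Q) = (\<integral>y. (a i y * a i y + b i y * b i y + 2 * (a i y * b i y)) / 4 \<partial>Q)"
        by (intro Bochner_Integration.integral_cong) (auto simp: mid_def power2_eq_square field_simps)
      moreover have "(\<integral>y. (a i y - b i y)\<^sup>2 \<partial>Q) = (\<integral>y. (a i y * a i y + b i y * b i y - 2 * (a i y * b i y)) \<partial>Q)"
        by (intro Bochner_Integration.integral_cong) (auto simp: power2_eq_square field_simps)
      ultimately show ?thesis
        using ip by (simp add: power2_eq_square)
    qed
    then have "(\<Sum>i=1..n. ((\<integral>y. (a i y)\<^sup>2 \<partial>Q) + (\<integral>y. (b i y)\<^sup>2 \<partial>Q)) / 2 - (\<integral>y. (mid a b i y)\<^sup>2 \<partial>Q))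
        = (\<Sum>i=1..n. (\<integral>y. (a i y - b i y)\<^sup>2 \<partial>Q) / 4)"
      by (intro sum.cong) auto
    then show ?thesis
      by (simp only: E_def sum_subtractf sum.distrib sum_divide_distrib[symmetric])
  qed
  have J_mid': "?J (mid a b) \<le> max (?J a) (?J b)" if "a \<in> ?K" "b \<in> ?K" for a b
    unfolding J_mid[OF that] by (simp add: max_def)
  have K_ne: "?K \<noteq> {}" using uniform_allocation[OF n] by auto
  obtain u where u: "\<And>k. u k \<in> ?K" "(\<lambda>k. ?J (u k)) \<longlonglongrightarrow> Inf (?J ` ?K)"
    "\<And>\<epsilon>. \<epsilon> > 0 \<Longrightarrow> \<exists>N. \<forall>k\<ge>N. \<forall>l\<ge>N. (E (u k) + E (u l)) / 2 - E (mid (u k) (u l)) < \<epsilon>"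
    using midpoint_minimising_sequence[of ?K mid ?J 0 E "real n", OF K_ne mid_in J_mid' J_nonneg E_nonneg E_le]
    by blast
  have int_u: "integrable Q (u k i)" if "i \<in> {1..n}" for i k
    by (rule int_g[OF u(1) that])
  have "\<exists>N. \<forall>k\<ge>N. \<forall>l\<ge>N. (\<integral>y. norm (u k i y - u l i y) \<partial>Q) < e" if i: "i \<in> {1..n}" and e: "e > 0" for i e
  proof -
    have d2: "(\<integral>y. norm (u k i y - u l i y) \<partial>Q)\<^sup>2 \<le> 4 * ((E (u k) + E (u l)) / 2 - E (mid (u k) (u l)))" for k l
    proof -
      have int2: "integrable Q (\<lambda>y. (u k j y - u l j y)\<^sup>2)" if "j \<in> {1..n}" for j
      proof -
        have "integrable Q (\<lambda>y. u k j y * u k j y + u l j y * u l j y - 2 * (u k j y * u l j y))"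
          using int_prod[OF u(1)[of k] u(1)[of k] that] int_prod[OF u(1)[of l] u(1)[of l] that]
            int_prod[OF u(1)[of k] u(1)[of l] that] by auto
        then show ?thesis by (simp add: power2_eq_square algebra_simps)
      qed
      have "(\<integral>y. norm (u k i y - u l i y) \<partial>Q)\<^sup>2 \<le> (\<integral>y. (norm (u k i y - u l i y))\<^sup>2 \<partial>Q)"
        using int2[OF i] int_u[OF i] by (intro expectation_power2_le) auto
      also have "\<dots> \<le> (\<Sum>j=1..n. \<integral>y. (u k j y - u l j y)\<^sup>2 \<partial>Q)"
        using i by (intro order_trans[OF _ member_le_sum[of i]]) auto
      finally show ?thesis
        unfolding E_mid[OF u(1)[of k] u(1)[of l]] by simp
    qed
    obtain N where N: "\<forall>k\<ge>N. \<forall>l\<ge>N. (E (u k) + E (u l)) / 2 - E (mid (u k) (u l)) < e\<^sup>2 / 4"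
      using u(3)[of "e\<^sup>2 / 4"] e by auto
    have "(\<integral>y. norm (u k i y - u l i y) \<partial>Q) < e" if "k \<ge> N" "l \<ge> N" for k l
    proof (rule power2_less_imp_less)
      show "(\<integral>y. norm (u k i y - u l i y) \<partial>Q)\<^sup>2 < e\<^sup>2"
      proof (rule order.strict_trans1[OF d2])
        have "(E (u k) + E (u l)) / 2 - E (mid (u k) (u l)) < e\<^sup>2 / 4"
          using N that by blast
        from mult_strict_left_mono[OF this, of 4]
        show "4 * ((E (u k) + E (u l)) / 2 - E (mid (u k) (u l))) < e\<^sup>2"
          by (simp only: times_divide_eq_right nonzero_mult_div_cancel_left[of 4])
      qed
    qed (use e in simp)
    then show ?thesis by blast
  qed
  then obtain r where r: "strict_mono r" "\<And>i. i \<in> {1..n} \<Longrightarrow> AE y in Q. Cauchy (\<lambda>k. u (r k) i y)"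
    using cauchy_L1_AE_cauchy_subseq_finite[of "{1..n}" Q u] int_u by blast
  define v where "v k = u (r k)" for k
  define g where "g i y = lim (\<lambda>k. v k i y)" for i y
  have v: "v k \<in> ?K" for k unfolding v_def by (rule u(1))
  have g_m: "g i \<in> borel_measurable borel" if "i \<in> {1..n}" for i
    unfolding g_def using allocationsD(1)[OF v that] by (intro borel_measurable_lim_metric)
  have lim: "AE y in Q. (\<lambda>k. v k i y) \<longlonglongrightarrow> g i y" if "i \<in> {1..n}" for i
    using r(2)[OF that] unfolding g_def v_def
    by eventually_elim (simp add: Cauchy_convergent convergent_LIMSEQ_iff[symmetric])
  have v_AE: "AE y in Q. \<forall>k. (\<forall>i\<in>{1..n}. 0 \<le> v k i y \<and> v k i y \<le> 1) \<and> (\<Sum>i=1..n. v k i y) = 1"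
    unfolding AE_all_countable using allocation_AE[OF v] by simp
  have all_lim: "AE y in Q. \<forall>i\<in>{1..n}. (\<lambda>k. v k i y) \<longlonglongrightarrow> g i y"
    using lim by (intro AE_finite_allI) auto
  have int_lim: "(\<lambda>k. \<integral>y. h y * v k i y \<partial>Q) \<longlonglongrightarrow> (\<integral>y. h y * g i y \<partial>Q)"
    if i: "i \<in> {1..n}" and h: "integrable Q h" for i and h :: "'a \<Rightarrow> real"
  proof (rule integral_dominated_convergence[where w = "\<lambda>y. norm (h y)"])
    show "(\<lambda>y. h y * g i y) \<in> borel_measurable Q"
      using g_m[OF i] h sets_Q by auto
    show "(\<lambda>y. h y * v k i y) \<in> borel_measurable Q" for k
      using integrable_mult_allocation[OF v i h] by auto
    show "AE y in Q. (\<lambda>k. h y * v k i y) \<longlonglongrightarrow> h y * g i y"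
      using lim[OF i] by eventually_elim (intro tendsto_intros)
    show "AE y in Q. norm (h y * v k i y) \<le> norm (h y)" for k
      using v_AE
    proof eventually_elim
      case (elim y)
      then have "\<bar>v k i y\<bar> \<le> 1" using i by auto
      then show ?case by (simp add: abs_mult mult_left_le)
    qed
  qed (use h in auto)
  have g: "g \<in> ?K"
  proof -
    have nn: "AE y in Q. 0 \<le> g i y" if i: "i \<in> {1..n}" for i
      using lim[OF i] v_AE by eventually_elim (use i in \<open>auto intro!: LIMSEQ_le_const\<close>)
    have "(\<integral>y. g i y \<partial>Q) = 1 / real n" if i: "i \<in> {1..n}" for i
      using int_lim[OF i, of "\<lambda>_. 1"] allocationsD(3)[OF v i] by (auto simp: LIMSEQ_const_iff)
    moreover have "AE y in Q. (\<Sum>i=1..n. g i y) = 1"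
      using all_lim v_AE
    proof eventually_elim
      case (elim y)
      have "(\<lambda>k. \<Sum>i=1..n. v k i y) \<longlonglongrightarrow> (\<Sum>i=1..n. g i y)"
        using elim by (intro tendsto_sum) auto
      then show ?case using elim by (simp add: LIMSEQ_const_iff)
    qed
    ultimately show ?thesis using g_m nn by (auto simp: allocations_def)
  qed
  have "(\<lambda>k. ?J (v k)) \<longlonglongrightarrow> ?J g"
    unfolding allocation_cost_def by (intro tendsto_sum int_lim int_c) auto
  moreover have "(\<lambda>k. ?J (v k)) \<longlonglongrightarrow> Inf (?J ` ?K)"
    using LIMSEQ_subseq_LIMSEQ[OF u(2) r(1)] by (simp add: v_def comp_def)
  ultimately have "?J g = Inf (?J ` ?K)" by (rule LIMSEQ_unique)
  moreover have "Inf (?J ` ?K) \<le> ?J h" if "h \<in> ?K" for h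
    using that J_nonneg by (intro cInf_lower bdd_belowI2[where m = 0]) auto
  ultimately show ?thesis using g that by simp
qed

lemma nn_cost_eq_allocation_cost:
  assumes g: "g \<in> allocations Q n" and rep: "represents Q n x g \<pi>" and sq: "integrable Q (\<lambda>y. (norm y)\<^sup>2)"
  shows "(\<integral>\<^sup>+ z. ennreal ((norm (fst z - snd z))\<^sup>2) \<partial>\<pi>) = ennreal (allocation_cost Q n x g)"
proof -
  have "(\<lambda>z. ennreal ((norm (fst z - snd z))\<^sup>2)) \<in> borel_measurable (borel :: ('a \<times> 'a) measure)"
    by (simp add: borel_prod[symmetric])
  with rep have "(\<integral>\<^sup>+ z. ennreal ((norm (fst z - snd z))\<^sup>2) \<partial>\<pi>)
      = (\<Sum>i=1..n. \<integral>\<^sup>+ y. ennreal ((norm (x i - y))\<^sup>2) * ennreal (g i y) \<partial>Q)"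
    unfolding represents_def by fastforce
  also have "\<dots> = (\<Sum>i=1..n. ennreal (\<integral>y. (norm (x i - y))\<^sup>2 * g i y \<partial>Q))"
  proof (rule sum.cong[OF refl])
    fix i assume i: "i \<in> {1..n}"
    have "(\<integral>\<^sup>+ y. ennreal ((norm (x i - y))\<^sup>2) * ennreal (g i y) \<partial>Q) = (\<integral>\<^sup>+ y. ennreal ((norm (x i - y))\<^sup>2 * g i y) \<partial>Q)"
      by (simp add: ennreal_mult')
    also have "\<dots> = ennreal (\<integral>y. (norm (x i - y))\<^sup>2 * g i y \<partial>Q)"
    proof (rule nn_integral_eq_integral[OF integrable_mult_allocation[OF g i integrable_norm_diff_power2[OF sq]]])
      show "AE y in Q. 0 \<le> (norm (x i - y))\<^sup>2 * g i y"
        using allocationsD(2)[OF g i] by eventually_elim simp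
    qed
    finally show "(\<integral>\<^sup>+ y. ennreal ((norm (x i - y))\<^sup>2) * ennreal (g i y) \<partial>Q)
        = ennreal (\<integral>y. (norm (x i - y))\<^sup>2 * g i y \<partial>Q)" .
  qed
  also have "\<dots> = ennreal (allocation_cost Q n x g)"
    unfolding allocation_cost_def
  proof (rule sum_ennreal)
    fix i assume i: "i \<in> {1..n}"
    show "0 \<le> (\<integral>y. (norm (x i - y))\<^sup>2 * g i y \<partial>Q)"
      by (rule integral_nonneg_AE, use allocationsD(2)[OF g i] in eventually_elim) simp
  qed
  finally show ?thesis .
qed

text \<open>
  Couplings and allocations have the same costs, so an optimal allocation shows that the least cost
  is attained and equals its own cost.
\<close>

theorem W2_sq_empirical_optimal_allocation:
  assumes n: "n \<ge> 1" and sq: "integrable Q (\<lambda>y. (norm y)\<^sup>2)"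
  obtains g where "g \<in> allocations Q n" "enn2real (W2_sq (empirical_measure n x) Q) = allocation_cost Q n x g"
    "\<And>h. h \<in> allocations Q n \<Longrightarrow> allocation_cost Q n x g \<le> allocation_cost Q n x h"
proof -
  obtain g where g: "g \<in> allocations Q n"
    "\<And>h. h \<in> allocations Q n \<Longrightarrow> allocation_cost Q n x g \<le> allocation_cost Q n x h"
    using optimal_allocation_exists[OF n sq, of x] by blast
  have "W2_sq (empirical_measure n x) Q = ennreal (allocation_cost Q n x g)"
    unfolding W2_sq_def
  proof (rule Least_equality)
    obtain \<pi> where "\<pi> \<in> couplings (empirical_measure n x) Q" "represents Q n x g \<pi>"
      by (rule coupling_of_allocation[OF g(1) n, where x = x])
    then show "\<exists>\<pi>\<in>couplings (empirical_measure n x) Q.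
        ennreal (allocation_cost Q n x g) = (\<integral>\<^sup>+ z. ennreal ((norm (fst z - snd z))\<^sup>2) \<partial>\<pi>)"
      using nn_cost_eq_allocation_cost[OF g(1) _ sq] by metis
  next
    fix c assume "\<exists>\<pi>\<in>couplings (empirical_measure n x) Q. c = (\<integral>\<^sup>+ z. ennreal ((norm (fst z - snd z))\<^sup>2) \<partial>\<pi>)"
    then obtain \<pi> where \<pi>: "\<pi> \<in> couplings (empirical_measure n x) Q"
      and c: "c = (\<integral>\<^sup>+ z. ennreal ((norm (fst z - snd z))\<^sup>2) \<partial>\<pi>)" by blast
    obtain h where h: "h \<in> allocations Q n" "represents Q n x h \<pi>"
      by (rule allocation_of_coupling[OF \<pi> n])
    show "ennreal (allocation_cost Q n x g) \<le> c"
      unfolding c nn_cost_eq_allocation_cost[OF h sq] by (rule ennreal_leI[OF g(2)[OF h(1)]])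
  qed
  then show ?thesis using g that allocation_cost_nonneg[OF g(1)] by simp
qed

end

section \<open>Stability of the transport cost under moving sample points\<close>

definition empirical_W2_sq :: "'a::euclidean_space measure \<Rightarrow> nat \<Rightarrow> (nat \<Rightarrow> 'a) \<Rightarrow> real" where
  "empirical_W2_sq Q n x = enn2real (W2_sq (empirical_measure n x) Q)"

lemma empirical_measure_cong:
  "(\<And>i. i \<in> {1..n} \<Longrightarrow> x i = y i) \<Longrightarrow> empirical_measure n x = empirical_measure n y"
  by (rule measure_eqI) (auto simp: emeasure_empirical_measure)

lemma empirical_W2_sq_cong:
  "(\<And>i. i \<in> {1..n} \<Longrightarrow> x i = y i) \<Longrightarrow> empirical_W2_sq Q n x = empirical_W2_sq Q n y"
  unfolding empirical_W2_sq_def by (metis empirical_measure_cong)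

locale fourth_moment_target = target_measure +
  assumes m4: "integrable Q (\<lambda>y. norm y ^ 4)"
begin

lemma integrable_norm_power2: "integrable Q (\<lambda>y. (norm y)\<^sup>2)"
proof (rule Bochner_Integration.integrable_bound)
  show "integrable Q (\<lambda>y. 1 + norm y ^ 4)" using m4 by simp
  have "t\<^sup>2 \<le> 1 + t ^ 4" for t :: real
  proof -
    have "2 * t\<^sup>2 \<le> 1 + t ^ 4" "0 \<le> t\<^sup>2"
      using sum_squares_bound[of 1 "t\<^sup>2"] by (simp_all add: power_mult[symmetric])
    then show ?thesis by linarith
  qed
  then show "AE y in Q. norm ((norm y)\<^sup>2) \<le> norm (1 + norm y ^ 4)" by simp
qed measurable

lemma integrable_norm_Q: "integrable Q (\<lambda>y. norm y)"
  by (rule square_integrable_imp_integrable) (auto intro: integrable_norm_power2)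

lemma optimal_allocation:
  assumes "n \<ge> 1"
  obtains g where "g \<in> allocations Q n" "empirical_W2_sq Q n x = allocation_cost Q n x g"
  using W2_sq_empirical_optimal_allocation[OF assms integrable_norm_power2, of x] unfolding empirical_W2_sq_def by metis

lemma empirical_W2_sq_le_allocation_cost:
  assumes "n \<ge> 1" "h \<in> allocations Q n"
  shows "empirical_W2_sq Q n x \<le> allocation_cost Q n x h"
  using W2_sq_empirical_optimal_allocation[OF assms(1) integrable_norm_power2, of x] assms(2)
  unfolding empirical_W2_sq_def by metis

text \<open>
  Upper bound by the cost of the product coupling, in which every part is Q/n.
\<close>

lemma empirical_W2_sq_le:
  assumes n: "n \<ge> 1"
  shows "empirical_W2_sq Q n x \<le> (\<Sum>i=1..n. 2 * (norm (x i))\<^sup>2) + 2 * real n * (\<integral>y. (norm y)\<^sup>2 \<partial>Q)"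
proof -
  have "empirical_W2_sq Q n x \<le> allocation_cost Q n x (\<lambda>i y. 1 / real n)"
    by (rule empirical_W2_sq_le_allocation_cost[OF n uniform_allocation[OF n]])
  also have "\<dots> \<le> (\<Sum>i=1..n. 2 * (norm (x i))\<^sup>2 + 2 * (\<integral>y. (norm y)\<^sup>2 \<partial>Q))"
    unfolding allocation_cost_def
  proof (rule sum_mono)
    fix i assume i: "i \<in> {1..n}"
    have "(\<integral>y. (norm (x i - y))\<^sup>2 * (1 / real n) \<partial>Q) \<le> (\<integral>y. 2 * (norm (x i))\<^sup>2 + 2 * (norm y)\<^sup>2 \<partial>Q)"
    proof (rule integral_mono)
      show "integrable Q (\<lambda>y. (norm (x i - y))\<^sup>2 * (1 / real n))"
        by (rule integrable_mult_allocation[OF uniform_allocation[OF n] i integrable_norm_diff_power2[OF integrable_norm_power2]])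
      show "integrable Q (\<lambda>y. 2 * (norm (x i))\<^sup>2 + 2 * (norm y)\<^sup>2)" using integrable_norm_power2 by simp
      fix y
      have "(norm (x i - y))\<^sup>2 * (1 / real n) \<le> (norm (x i - y))\<^sup>2"
        using n by (intro mult_left_le) auto
      then show "(norm (x i - y))\<^sup>2 * (1 / real n) \<le> 2 * (norm (x i))\<^sup>2 + 2 * (norm y)\<^sup>2"
        using norm_diff_power2_le[of "x i" y] by linarith
    qed
    also have "\<dots> = 2 * (norm (x i))\<^sup>2 + 2 * (\<integral>y. (norm y)\<^sup>2 \<partial>Q)"
      using integrable_norm_power2 prob_space by simp
    finally show "(\<integral>y. (norm (x i - y))\<^sup>2 * (1 / real n) \<partial>Q) \<le> 2 * (norm (x i))\<^sup>2 + 2 * (\<integral>y. (norm y)\<^sup>2 \<partial>Q)" .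
  qed
  finally show ?thesis by (simp add: sum.distrib algebra_simps)
qed

lemma integrable_displacement: "integrable Q (\<lambda>y. norm (c - 2 *\<^sub>R y))"
proof (rule Bochner_Integration.integrable_bound)
  show "integrable Q (\<lambda>y. norm c + 2 * norm y)" using integrable_norm_Q by simp
  show "AE y in Q. norm (norm (c - 2 *\<^sub>R y)) \<le> norm (norm c + 2 * norm y)"
    using norm_triangle_ineq4[of c "2 *\<^sub>R _"] by simp
qed measurable

lemma allocation_cost_perturbation:
  assumes n: "n \<ge> 1" and g: "g \<in> allocations Q n"
  shows "allocation_cost Q n x' g - allocation_cost Q n x g
    \<le> (\<Sum>i=1..n. norm (x' i - x i) * (\<integral>y. norm (x' i + x i - 2 *\<^sub>R y) * g i y \<partial>Q))"
proof -
  note sqd = integrable_norm_diff_power2[OF integrable_norm_power2]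
  have "(\<integral>y. (norm (x' i - y))\<^sup>2 * g i y \<partial>Q) - (\<integral>y. (norm (x i - y))\<^sup>2 * g i y \<partial>Q)
      \<le> norm (x' i - x i) * (\<integral>y. norm (x' i + x i - 2 *\<^sub>R y) * g i y \<partial>Q)" if i: "i \<in> {1..n}" for i
  proof -
    note ia = integrable_mult_allocation[OF g i sqd[of "x' i"]] and ib = integrable_mult_allocation[OF g i sqd[of "x i"]]
      and ic = integrable_mult_allocation[OF g i integrable_displacement[of "x' i + x i"]]
    have "(\<integral>y. (norm (x' i - y))\<^sup>2 * g i y \<partial>Q) - (\<integral>y. (norm (x i - y))\<^sup>2 * g i y \<partial>Q)
        = (\<integral>y. (norm (x' i - y))\<^sup>2 * g i y - (norm (x i - y))\<^sup>2 * g i y \<partial>Q)"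
      using ia ib by simp
    also have "\<dots> \<le> (\<integral>y. norm (x' i - x i) * (norm (x' i + x i - 2 *\<^sub>R y) * g i y) \<partial>Q)"
    proof (rule integral_mono_AE)
      show "AE y in Q. (norm (x' i - y))\<^sup>2 * g i y - (norm (x i - y))\<^sup>2 * g i y
          \<le> norm (x' i - x i) * (norm (x' i + x i - 2 *\<^sub>R y) * g i y)"
        using allocationsD(2)[OF g i]
      proof eventually_elim
        case (elim y)
        from mult_right_mono[OF norm_power2_diff_le[of "x' i" y "x i"] elim]
        show ?case by (simp add: algebra_simps)
      qed
    qed (use ia ib ic in auto)
    also have "\<dots> = norm (x' i - x i) * (\<integral>y. norm (x' i + x i - 2 *\<^sub>R y) * g i y \<partial>Q)"
      by simp
    finally show ?thesis .
  qed
  then show ?thesis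
    unfolding allocation_cost_def sum_subtractf[symmetric] by (intro sum_mono) auto
qed

text \<open>
  An allocation optimal for x is admissible for x' and conversely; together with the symmetry of the
  bound this gives an estimate in both directions. It serves to prove measurability of W.
\<close>

lemma empirical_W2_sq_local_Lipschitz:
  assumes n: "n \<ge> 1"
  shows "\<bar>empirical_W2_sq Q n x' - empirical_W2_sq Q n x\<bar>
    \<le> (\<Sum>i=1..n. norm (x' i - x i) * (norm (x' i + x i) + 2 * (\<integral>y. norm y \<partial>Q)))" (is "_ \<le> ?R x' x")
proof -
  have *: "empirical_W2_sq Q n x' - empirical_W2_sq Q n x \<le> ?R x' x" for x x'
  proof -
    obtain g where g: "g \<in> allocations Q n" "empirical_W2_sq Q n x = allocation_cost Q n x g"
      by (rule optimal_allocation[OF n, of x])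
    have "empirical_W2_sq Q n x' - empirical_W2_sq Q n x \<le> allocation_cost Q n x' g - allocation_cost Q n x g"
      using empirical_W2_sq_le_allocation_cost[OF n g(1), of x'] g(2) by simp
    also have "\<dots> \<le> (\<Sum>i=1..n. norm (x' i - x i) * (\<integral>y. norm (x' i + x i - 2 *\<^sub>R y) * g i y \<partial>Q))"
      by (rule allocation_cost_perturbation[OF n g(1)])
    also have "\<dots> \<le> ?R x' x"
    proof (intro sum_mono mult_left_mono)
      fix i assume i: "i \<in> {1..n}"
      have "(\<integral>y. norm (x' i + x i - 2 *\<^sub>R y) * g i y \<partial>Q) \<le> (\<integral>y. norm (x' i + x i) + 2 * norm y \<partial>Q)"
      proof (rule integral_mono_AE)
        show "AE y in Q. norm (x' i + x i - 2 *\<^sub>R y) * g i y \<le> norm (x' i + x i) + 2 * norm y"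
          using allocation_AE[OF g(1)]
        proof eventually_elim
          case (elim y)
          then have "norm (x' i + x i - 2 *\<^sub>R y) * g i y \<le> norm (x' i + x i - 2 *\<^sub>R y)"
            using i by (intro mult_left_le) auto
          then show ?case using norm_triangle_ineq4[of "x' i + x i" "2 *\<^sub>R y"] by simp
        qed
      qed (use integrable_mult_allocation[OF g(1) i integrable_displacement] integrable_norm_Q in auto)
      then show "(\<integral>y. norm (x' i + x i - 2 *\<^sub>R y) * g i y \<partial>Q) \<le> norm (x' i + x i) + 2 * (\<integral>y. norm y \<partial>Q)"
        using integrable_norm_Q prob_space by simp
    qed simp
    finally show ?thesis .
  qed
  have "?R x x' = ?R x' x"
    by (simp add: norm_minus_commute add.commute)
  then show ?thesis using *[of x' x] *[of x x'] by linarith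
qed

text \<open>
  Continuity refers to the product topology on sequences, whose Borel sets are generated by the
  coordinates.
\<close>

lemma continuous_empirical_W2_sq:
  assumes n: "n \<ge> 1"
  shows "continuous_on UNIV (empirical_W2_sq Q n)"
  unfolding continuous_on_def
proof (intro ballI)
  fix x :: "nat \<Rightarrow> 'a"
  let ?R = "\<lambda>x'. \<Sum>i=1..n. norm (x' i - x i) * (norm (x' i + x i) + 2 * (\<integral>y. norm y \<partial>Q))"
  have coord: "((\<lambda>x'. x' i) \<longlongrightarrow> x i) (at x)" for i
    using continuous_on_product_coordinates[of i] unfolding continuous_on_def by blast
  have "(?R \<longlongrightarrow> (\<Sum>i=1..n. norm (x i - x i) * (norm (x i + x i) + 2 * (\<integral>y. norm y \<partial>Q)))) (at x)"
    by (intro tendsto_intros coord)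
  then have R0: "(?R \<longlongrightarrow> 0) (at x)" by simp
  have "((\<lambda>x'. empirical_W2_sq Q n x' - empirical_W2_sq Q n x) \<longlongrightarrow> 0) (at x)"
    by (rule Lim_null_comparison[OF _ R0])
      (use empirical_W2_sq_local_Lipschitz[OF n] in \<open>auto intro!: always_eventually\<close>)
  then show "(empirical_W2_sq Q n \<longlongrightarrow> empirical_W2_sq Q n x) (at x)"
    by (simp add: LIM_zero_iff)
qed

lemma empirical_W2_sq_measurable:
  assumes n: "n \<ge> 1"
  shows "empirical_W2_sq Q n \<in> borel_measurable (PiM {1..n} (\<lambda>_. borel))"
proof -
  have "empirical_W2_sq Q n \<in> borel_measurable (PiM UNIV (\<lambda>_. borel))"
    using borel_measurable_continuous_onI[OF continuous_empirical_W2_sq[OF n]]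
    by (simp add: measurable_cong_sets[OF sets_PiM_equal_borel refl])
  moreover have "(\<lambda>x i. if i \<in> {1..n} then x i else 0) \<in> measurable (PiM {1..n} (\<lambda>_. borel)) (PiM UNIV (\<lambda>_. borel :: 'a measure))"
  proof (rule measurable_PiM_single')
    show "(\<lambda>x. if i \<in> {1..n} then x i else 0) \<in> measurable (PiM {1..n} (\<lambda>_. borel :: 'a measure)) borel" for i
      by (cases "i \<in> {1..n}") (auto intro: measurable_component_singleton)
  qed (auto simp: space_PiM)
  ultimately have "(\<lambda>x. empirical_W2_sq Q n (\<lambda>i. if i \<in> {1..n} then x i else 0)) \<in> borel_measurable (PiM {1..n} (\<lambda>_. borel))"
    by (rule measurable_compose[rotated])
  moreover have "empirical_W2_sq Q n (\<lambda>i. if i \<in> {1..n} then x i else 0) = empirical_W2_sq Q n x" for x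
    by (rule empirical_W2_sq_cong) auto
  ultimately show ?thesis by simp
qed

text \<open>
  Cauchy--Schwarz inequality for the measure with density g i, whose total mass is 1/n: with t chosen
  as the mean of f for the normalised measure, expand the nonnegative integral of (t - f)^2.
\<close>

lemma weighted_integral_power2_le:
  assumes g: "g \<in> allocations Q n" and i: "i \<in> {1..n}"
    and f: "integrable Q f" "integrable Q (\<lambda>y. (f y)\<^sup>2)"
  shows "(\<integral>y. f y * g i y \<partial>Q)\<^sup>2 \<le> (\<integral>y. (f y)\<^sup>2 * g i y \<partial>Q) / real n"
proof -
  define b where "b = (\<integral>y. f y * g i y \<partial>Q)"
  define t where "t = real n * b"
  note ints = integrable_mult_allocation[OF g i f(1)] integrable_mult_allocation[OF g i f(2)] integrable_allocation[OF g i]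
  have n: "real n > 0" using i by auto
  have "0 \<le> (\<integral>y. (t - f y)\<^sup>2 * g i y \<partial>Q)"
    by (rule integral_nonneg_AE, use allocationsD(2)[OF g i] in eventually_elim) simp
  also have "(\<integral>y. (t - f y)\<^sup>2 * g i y \<partial>Q) = (\<integral>y. t\<^sup>2 * g i y - 2 * t * (f y * g i y) + (f y)\<^sup>2 * g i y \<partial>Q)"
    by (intro Bochner_Integration.integral_cong) (auto simp: power2_eq_square algebra_simps)
  also have "\<dots> = t\<^sup>2 * (1 / real n) - 2 * t * b + (\<integral>y. (f y)\<^sup>2 * g i y \<partial>Q)"
    using ints allocationsD(3)[OF g i] by (simp add: b_def)
  also have "t\<^sup>2 * (1 / real n) - 2 * t * b = - real n * b\<^sup>2"
    using n by (simp add: t_def power2_eq_square)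
  finally show ?thesis
    using n by (simp add: b_def[symmetric] field_simps)
qed

text \<open>
  Two applications of the Cauchy--Schwarz inequality: first over the labels, then within each part,
  where it turns squares of second moments into fourth moments. The latter add up to the fourth
  moment of Q since the parts add up to Q.
\<close>

lemma sum_weighted_second_moments_le:
  assumes g: "g \<in> allocations Q n"
  shows "(\<Sum>i=1..n. c i * (\<integral>y. (norm y)\<^sup>2 * g i y \<partial>Q))
    \<le> sqrt (\<Sum>i=1..n. (c i)\<^sup>2) * sqrt ((\<integral>y. norm y ^ 4 \<partial>Q) / real n)"
proof -
  define A where "A i = (\<integral>y. (norm y)\<^sup>2 * g i y \<partial>Q)" for i
  have "(A i)\<^sup>2 \<le> (\<integral>y. norm y ^ 4 * g i y \<partial>Q) / real n" if i: "i \<in> {1..n}" for i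
    using weighted_integral_power2_le[OF g i integrable_norm_power2] m4 by (simp add: A_def power_mult[symmetric])
  then have "(\<Sum>i=1..n. (A i)\<^sup>2) \<le> (\<Sum>i=1..n. (\<integral>y. norm y ^ 4 * g i y \<partial>Q) / real n)"
    by (rule sum_mono)
  also have "\<dots> = (\<integral>y. norm y ^ 4 \<partial>Q) / real n"
    using sum_integral_allocation[OF g m4] by (simp add: sum_divide_distrib[symmetric])
  finally have "sqrt (\<Sum>i=1..n. (A i)\<^sup>2) \<le> sqrt ((\<integral>y. norm y ^ 4 \<partial>Q) / real n)"
    by simp
  moreover have "(\<Sum>i=1..n. c i * A i) \<le> sqrt (\<Sum>i=1..n. (c i)\<^sup>2) * sqrt (\<Sum>i=1..n. (A i)\<^sup>2)"
    using L2_set_mult_ineq[of c A "{1..n}"] sum_mono[of "{1..n}" "\<lambda>i. c i * A i" "\<lambda>i. \<bar>c i\<bar> * \<bar>A i\<bar>"]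
    by (force simp: L2_set_def abs_mult[symmetric])
  ultimately show ?thesis
    unfolding A_def[symmetric] by (meson mult_left_mono order_trans real_sqrt_ge_zero sum_nonneg zero_le_power2)
qed

text \<open>
  The pointwise core of the argument. One allocation g, optimal for the original sample x, bounds the
  increase of the cost for every single replacement of x i by x' i simultaneously.
\<close>

lemma sum_resampling_increments:
  assumes n: "n \<ge> 1"
  shows "(\<Sum>i=1..n. (max 0 (empirical_W2_sq Q n (x(i := x' i)) - empirical_W2_sq Q n x))\<^sup>2)
    \<le> 4 / (real n)\<^sup>2 * (\<Sum>i=1..n. (norm (x i - x' i))\<^sup>2 * ((norm (x i))\<^sup>2 + (norm (x' i))\<^sup>2))
      + 8 / real n * (sqrt (\<Sum>i=1..n. norm (x i - x' i) ^ 4) * sqrt ((\<integral>y. norm y ^ 4 \<partial>Q) / real n))"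
proof -
  obtain g where g: "g \<in> allocations Q n" "empirical_W2_sq Q n x = allocation_cost Q n x g"
    by (rule optimal_allocation[OF n, of x])
  define A where "A i = (\<integral>y. (norm y)\<^sup>2 * g i y \<partial>Q)" for i
  let ?d = "\<lambda>i. norm (x i - x' i)"
  let ?s = "\<lambda>i. (norm (x i))\<^sup>2 + (norm (x' i))\<^sup>2"
  have inc: "(max 0 (empirical_W2_sq Q n (x(i := x' i)) - empirical_W2_sq Q n x))\<^sup>2
      \<le> (?d i)\<^sup>2 * ((4 * ?s i / real n + 8 * A i) / real n)" if i: "i \<in> {1..n}" for i
  proof -
    let ?f = "\<lambda>y. norm (x' i + x i - 2 *\<^sub>R y)"
    define B where "B = (\<integral>y. ?f y * g i y \<partial>Q)"
    \<comment> \<open>Splitting off 2y and then separating x' i from x i: twice the factor 2 from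
      |a - b|^2 \<le> 2 |a|^2 + 2 |b|^2.\<close>
    have f2: "(?f y)\<^sup>2 \<le> 4 * ?s i + 8 * (norm y)\<^sup>2" for y
      using norm_diff_power2_le[of "x' i + x i" "2 *\<^sub>R y"] norm_diff_power2_le[of "x' i" "- x i"]
      by (simp add: power_mult_distrib)
    have int_dom: "integrable Q (\<lambda>y. 4 * ?s i + 8 * (norm y)\<^sup>2)" using integrable_norm_power2 by simp
    have int_f2: "integrable Q (\<lambda>y. (?f y)\<^sup>2)"
    proof (rule Bochner_Integration.integrable_bound[OF int_dom])
      show "AE y in Q. norm ((?f y)\<^sup>2) \<le> norm (4 * ?s i + 8 * (norm y)\<^sup>2)"
        using f2 by (simp add: abs_of_nonneg)
    qed measurable
    have B0: "0 \<le> B"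
      unfolding B_def by (rule integral_nonneg_AE, use allocationsD(2)[OF g(1) i] in eventually_elim) simp
    have "empirical_W2_sq Q n (x(i := x' i)) - empirical_W2_sq Q n x
        \<le> allocation_cost Q n (x(i := x' i)) g - allocation_cost Q n x g"
      using empirical_W2_sq_le_allocation_cost[OF n g(1), of "x(i := x' i)"] g(2) by simp
    also have "\<dots> \<le> (\<Sum>j=1..n. norm ((x(i := x' i)) j - x j) * (\<integral>y. norm ((x(i := x' i)) j + x j - 2 *\<^sub>R y) * g j y \<partial>Q))"
      by (rule allocation_cost_perturbation[OF n g(1)])
    also have "\<dots> = (\<Sum>j\<in>{1..n}. if j = i then ?d i * B else 0)"
      by (rule sum.cong) (auto simp: B_def norm_minus_commute)
    also have "\<dots> = ?d i * B" using i by simp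
    finally have "max 0 (empirical_W2_sq Q n (x(i := x' i)) - empirical_W2_sq Q n x) \<le> ?d i * B"
      using B0 by simp
    then have "(max 0 (empirical_W2_sq Q n (x(i := x' i)) - empirical_W2_sq Q n x))\<^sup>2 \<le> (?d i * B)\<^sup>2"
      by (rule power_mono) simp
    also have "\<dots> = (?d i)\<^sup>2 * B\<^sup>2" by (rule power_mult_distrib)
    also have "\<dots> \<le> (?d i)\<^sup>2 * ((4 * ?s i / real n + 8 * A i) / real n)"
    proof (rule mult_left_mono)
      have "B\<^sup>2 \<le> (\<integral>y. (?f y)\<^sup>2 * g i y \<partial>Q) / real n"
        unfolding B_def by (rule weighted_integral_power2_le[OF g(1) i integrable_displacement int_f2])
      also have "(\<integral>y. (?f y)\<^sup>2 * g i y \<partial>Q) \<le> (\<integral>y. (4 * ?s i + 8 * (norm y)\<^sup>2) * g i y \<partial>Q)"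
      proof (rule integral_mono_AE)
        show "AE y in Q. (?f y)\<^sup>2 * g i y \<le> (4 * ?s i + 8 * (norm y)\<^sup>2) * g i y"
          using allocationsD(2)[OF g(1) i] by eventually_elim (intro mult_right_mono f2)
      qed (intro integrable_mult_allocation[OF g(1) i] int_f2 int_dom)+
      also have "(\<integral>y. (4 * ?s i + 8 * (norm y)\<^sup>2) * g i y \<partial>Q) = (\<integral>y. 4 * ?s i * g i y + 8 * ((norm y)\<^sup>2 * g i y) \<partial>Q)"
        by (simp add: algebra_simps)
      also have "\<dots> = 4 * ?s i / real n + 8 * A i"
        using integrable_allocation[OF g(1) i] integrable_mult_allocation[OF g(1) i integrable_norm_power2] allocationsD(3)[OF g(1) i]
        by (simp add: A_def)
      finally show "B\<^sup>2 \<le> (4 * ?s i / real n + 8 * A i) / real n"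
        using n by (simp add: divide_right_mono)
    qed simp
    finally show ?thesis .
  qed
  have "(\<Sum>i=1..n. (max 0 (empirical_W2_sq Q n (x(i := x' i)) - empirical_W2_sq Q n x))\<^sup>2)
      \<le> (\<Sum>i=1..n. (?d i)\<^sup>2 * ((4 * ?s i / real n + 8 * A i) / real n))"
    by (rule sum_mono) (rule inc)
  also have "\<dots> = (\<Sum>i=1..n. 4 / (real n)\<^sup>2 * ((?d i)\<^sup>2 * ?s i) + 8 / real n * ((?d i)\<^sup>2 * A i))"
    by (rule sum.cong) (auto simp: power2_eq_square add_divide_distrib algebra_simps)
  also have "\<dots> = 4 / (real n)\<^sup>2 * (\<Sum>i=1..n. (?d i)\<^sup>2 * ?s i) + 8 / real n * (\<Sum>i=1..n. (?d i)\<^sup>2 * A i)"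
    by (simp only: sum.distrib sum_distrib_left)
  also have "\<dots> \<le> 4 / (real n)\<^sup>2 * (\<Sum>i=1..n. (?d i)\<^sup>2 * ?s i)
      + 8 / real n * (sqrt (\<Sum>i=1..n. ((?d i)\<^sup>2)\<^sup>2) * sqrt ((\<integral>y. norm y ^ 4 \<partial>Q) / real n))"
    unfolding A_def by (intro add_left_mono mult_left_mono sum_weighted_second_moments_le[OF g(1)]) auto
  finally show ?thesis
    by (simp add: power_mult[symmetric])
qed

end

section \<open>The Efron--Stein inequality\<close>

text \<open>
  The coordinates n + 1, ..., 2n serve as an independent copy of the sample; those with label in A
  are exchanged for their copies. Restricting to {1..n} makes the result an element of the product
  space over {1..n}.
\<close>

definition hybrid_sample :: "nat \<Rightarrow> nat set \<Rightarrow> (nat \<Rightarrow> 'a) \<Rightarrow> nat \<Rightarrow> 'a" where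
  "hybrid_sample n A x = (\<lambda>j\<in>{1..n}. x (if j \<in> A then n + j else j))"

locale iid_sample = prob_space M for M :: "'w measure" +
  fixes X :: "nat \<Rightarrow> 'w \<Rightarrow> 'a" and N P :: "'a measure" and n :: nat
  assumes indep: "indep_vars (\<lambda>_. N) X {1..}"
    and ident: "\<And>i. i \<ge> 1 \<Longrightarrow> distr M N (X i) = P"
    and n_pos: "n \<ge> 1"
begin

lemma X_measurable: "i \<ge> 1 \<Longrightarrow> X i \<in> measurable M N"
  using indep unfolding indep_vars_def by auto

lemma prob_space_P: "prob_space P"
  using ident[of 1] prob_space_distr[OF X_measurable[of 1]] by simp

lemma sets_P: "sets P = sets N"
  using ident[of 1] by auto

lemma law_sample:
  assumes "I \<noteq> {}" "I \<subseteq> {1..}"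
  shows "distr M (PiM I (\<lambda>_. N)) (\<lambda>\<omega>. \<lambda>j\<in>I. X j \<omega>) = PiM I (\<lambda>_. P)"
proof -
  have "distr M (PiM I (\<lambda>_. N)) (\<lambda>\<omega>. \<lambda>j\<in>I. X j \<omega>) = PiM I (\<lambda>i. distr M N (X i))"
    using indep_vars_iff_distr_eq_PiM'[of I X "\<lambda>_. N"] assms X_measurable
      indep_vars_subset[OF indep assms(2)] by blast
  also have "\<dots> = PiM I (\<lambda>_. P)"
    using assms ident by (intro PiM_cong) auto
  finally show ?thesis .
qed

lemma law_sample_reindex:
  assumes \<tau>: "inj_on \<tau> I" "\<tau> \<in> I \<rightarrow> I" and I: "I \<noteq> {}" "I \<subseteq> {1..}"
  shows "distr M (PiM I (\<lambda>_. N)) (\<lambda>\<omega>. \<lambda>j\<in>I. X (\<tau> j) \<omega>) = PiM I (\<lambda>_. P)"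
proof -
  have m [measurable]: "(\<lambda>\<omega>. \<lambda>j\<in>I. X j \<omega>) \<in> measurable M (PiM I (\<lambda>_. N))"
    using I X_measurable by (intro measurable_restrict) auto
  have m2: "(\<lambda>x. \<lambda>j\<in>I. x (\<tau> j)) \<in> measurable (PiM I (\<lambda>_. N)) (PiM I (\<lambda>_. N))"
    using \<tau> by (intro measurable_restrict measurable_component_singleton) auto
  have "distr M (PiM I (\<lambda>_. N)) (\<lambda>\<omega>. \<lambda>j\<in>I. X (\<tau> j) \<omega>)
      = distr M (PiM I (\<lambda>_. N)) ((\<lambda>x. \<lambda>j\<in>I. x (\<tau> j)) \<circ> (\<lambda>\<omega>. \<lambda>j\<in>I. X j \<omega>))"
    using \<tau>(2) by (intro distr_cong) (auto simp: fun_eq_iff)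
  also have "\<dots> = distr (distr M (PiM I (\<lambda>_. N)) (\<lambda>\<omega>. \<lambda>j\<in>I. X j \<omega>)) (PiM I (\<lambda>_. N)) (\<lambda>x. \<lambda>j\<in>I. x (\<tau> j))"
    by (rule distr_distr[symmetric, OF m2 m])
  also have "\<dots> = distr (PiM I (\<lambda>_. P)) (PiM I (\<lambda>_. P)) (\<lambda>x. \<lambda>j\<in>I. x (\<tau> j))"
    unfolding law_sample[OF I] by (rule distr_cong) (auto intro!: sets_PiM_cong simp: sets_P)
  also have "\<dots> = PiM I (\<lambda>_. P)"
    using distr_PiM_reindex[of I "\<lambda>_. P" \<tau> I] prob_space_P \<tau> by simp
  finally show ?thesis .
qed

lemma law_pair:
  assumes "i \<ge> 1" "j \<ge> 1" "i \<noteq> j"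
  shows "distr M (N \<Otimes>\<^sub>M N) (\<lambda>\<omega>. (X i \<omega>, X j \<omega>)) = P \<Otimes>\<^sub>M P"
proof -
  have "indep_var (PiM {i} (\<lambda>_. N)) (\<lambda>\<omega>. restrict (\<lambda>i. X i \<omega>) {i})
      (PiM {j} (\<lambda>_. N)) (\<lambda>\<omega>. restrict (\<lambda>i. X i \<omega>) {j})"
    using assms by (intro indep_var_restrict[OF indep]) auto
  from indep_var_compose[OF this, of "\<lambda>x. x i" N "\<lambda>x. x j" N]
  have "indep_var N (X i) N (X j)"
    by (simp add: comp_def)
  then show ?thesis
    using assms ident by (simp add: indep_var_distribution_eq)
qed

lemma expectation_pair:
  assumes "\<phi> \<in> borel_measurable (N \<Otimes>\<^sub>M N)" "i \<ge> 1" "j \<ge> 1" "i \<noteq> j"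
  shows "expectation (\<lambda>\<omega>. \<phi> (X i \<omega>, X j \<omega>)) = (expectation (\<lambda>\<omega>. \<phi> (X 1 \<omega>, X 2 \<omega>)) :: real)"
proof -
  have "expectation (\<lambda>\<omega>. \<phi> (X i \<omega>, X j \<omega>)) = integral\<^sup>L (P \<Otimes>\<^sub>M P) \<phi>" if "i \<ge> 1" "j \<ge> 1" "i \<noteq> j" for i j
    unfolding law_pair[OF that, symmetric]
    using X_measurable that by (intro integral_distr[symmetric] assms(1) measurable_Pair) auto
  from this[of i j] this[of 1 2] show ?thesis using assms by simp
qed

definition hybrid_value :: "((nat \<Rightarrow> 'a) \<Rightarrow> real) \<Rightarrow> nat set \<Rightarrow> 'w \<Rightarrow> real" where
  "hybrid_value f A \<omega> = f (hybrid_sample n A (\<lambda>i. X i \<omega>))"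

context
  fixes f :: "(nat \<Rightarrow> 'a) \<Rightarrow> real"
  assumes f [measurable]: "f \<in> borel_measurable (PiM {1..n} (\<lambda>_. N))"
begin

lemma hybrid_value_measurable [measurable]: "hybrid_value f A \<in> borel_measurable M"
proof -
  have "(\<lambda>\<omega>. hybrid_sample n A (\<lambda>i. X i \<omega>)) \<in> measurable M (PiM {1..n} (\<lambda>_. N))"
    unfolding hybrid_sample_def using X_measurable
    by (intro measurable_restrict) auto
  then show ?thesis
    unfolding hybrid_value_def by measurable
qed

text \<open>
  Exchanging j and n + j for all j in S is a permutation of the i.i.d. family X 1, ..., X (2n), so it
  preserves the joint law. On hybrid samples it acts by symmetric difference with S.
\<close>

lemma law_hybrid_pair_swap:
  fixes S :: "nat set"
  defines "swap \<equiv> \<lambda>A. (A - S) \<union> (S - A)"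
  shows "distr M borel (\<lambda>\<omega>. (hybrid_value f A \<omega>, hybrid_value f B \<omega>))
    = distr M borel (\<lambda>\<omega>. (hybrid_value f (swap A) \<omega>, hybrid_value f (swap B) \<omega>))"
proof -
  define I where "I = {1..2 * n}"
  have I: "I \<noteq> {}" "I \<subseteq> {1..}"
    using n_pos by (auto simp: I_def)
  \<comment> \<open>On {1..2n} this exchanges j and n + j for j in S; the two branches treat the original labels
    and their copies.\<close>
  define \<tau> where "\<tau> j = (if j \<le> n then (if j \<in> S then n + j else j)
      else if j - n \<in> S then j - n else j)" for j
  have \<tau>I: "\<tau> \<in> I \<rightarrow> I" and \<tau>\<tau>: "\<And>j. j \<in> I \<Longrightarrow> \<tau> (\<tau> j) = j"
    by (auto simp: \<tau>_def I_def)
  have inj: "inj_on \<tau> I"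
    by (rule inj_on_inverseI[of _ \<tau>]) (rule \<tau>\<tau>)
  define G where "G x = (f (hybrid_sample n A x), f (hybrid_sample n B x))" for x
  have hm: "hybrid_sample n C \<in> measurable (PiM I (\<lambda>_. N)) (PiM {1..n} (\<lambda>_. N))" for C
    unfolding hybrid_sample_def
    by (intro measurable_restrict measurable_component_singleton) (auto simp: I_def)
  have G: "G \<in> measurable (PiM I (\<lambda>_. N)) borel"
    unfolding G_def using hm[of A] hm[of B] by measurable
  have m: "(\<lambda>\<omega>. \<lambda>j\<in>I. X j \<omega>) \<in> measurable M (PiM I (\<lambda>_. N))"
    using I X_measurable by (intro measurable_restrict) auto
  have m\<tau>: "(\<lambda>\<omega>. \<lambda>j\<in>I. X (\<tau> j) \<omega>) \<in> measurable M (PiM I (\<lambda>_. N))"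
    using I X_measurable \<tau>I by (intro measurable_restrict) auto
  have 1: "hybrid_sample n C (\<lambda>j\<in>I. x j) = hybrid_sample n C x" for C and x :: "nat \<Rightarrow> 'a"
    by (auto simp: hybrid_sample_def I_def fun_eq_iff)
  have 2: "hybrid_sample n C (\<lambda>j\<in>I. x (\<tau> j)) = hybrid_sample n (swap C) x" for C and x :: "nat \<Rightarrow> 'a"
    by (auto simp: hybrid_sample_def I_def fun_eq_iff \<tau>_def swap_def)
  have "distr M borel (G \<circ> (\<lambda>\<omega>. \<lambda>j\<in>I. X j \<omega>)) = distr M borel (G \<circ> (\<lambda>\<omega>. \<lambda>j\<in>I. X (\<tau> j) \<omega>))"
    unfolding distr_distr[OF G m, symmetric] distr_distr[OF G m\<tau>, symmetric]
      law_sample[OF I] law_sample_reindex[OF inj \<tau>I I] ..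
  moreover have "G \<circ> (\<lambda>\<omega>. \<lambda>j\<in>I. X j \<omega>) = (\<lambda>\<omega>. (hybrid_value f A \<omega>, hybrid_value f B \<omega>))"
    by (simp only: comp_def G_def 1 hybrid_value_def)
  moreover have "G \<circ> (\<lambda>\<omega>. \<lambda>j\<in>I. X (\<tau> j) \<omega>) = (\<lambda>\<omega>. (hybrid_value f (swap A) \<omega>, hybrid_value f (swap B) \<omega>))"
    by (simp only: comp_def G_def 2[of _ "\<lambda>i. X i \<omega>" for \<omega>] hybrid_value_def)
  ultimately show ?thesis by simp
qed

lemma expectation_hybrid_pair_swap:
  assumes \<phi>: "\<phi> \<in> borel_measurable (borel :: (real \<times> real) measure)"
  shows "expectation (\<lambda>\<omega>. \<phi> (hybrid_value f A \<omega>, hybrid_value f B \<omega>))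
    = (expectation (\<lambda>\<omega>. \<phi> (hybrid_value f ((A - S) \<union> (S - A)) \<omega>, hybrid_value f ((B - S) \<union> (S - B)) \<omega>)) :: real)"
proof -
  have "expectation (\<lambda>\<omega>. \<phi> (hybrid_value f A \<omega>, hybrid_value f B \<omega>))
      = integral\<^sup>L (distr M borel (\<lambda>\<omega>. (hybrid_value f A \<omega>, hybrid_value f B \<omega>))) \<phi>"
    by (rule integral_distr[symmetric, OF _ \<phi>]) measurable
  also have "\<dots> = expectation (\<lambda>\<omega>. \<phi> (hybrid_value f ((A - S) \<union> (S - A)) \<omega>, hybrid_value f ((B - S) \<union> (S - B)) \<omega>))"
    unfolding law_hybrid_pair_swap[of A B S]
    by (rule integral_distr[OF _ \<phi>]) measurable
  finally show ?thesis .
qed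

lemma integrable_hybrid_value_power2:
  assumes "integrable M (\<lambda>\<omega>. (hybrid_value f {} \<omega>)\<^sup>2)"
  shows "integrable M (\<lambda>\<omega>. (hybrid_value f A \<omega>)\<^sup>2)"
proof -
  have "integrable (distr M borel (\<lambda>\<omega>. (hybrid_value f C \<omega>, hybrid_value f C \<omega>))) (\<lambda>p. (fst p)\<^sup>2)
      \<longleftrightarrow> integrable M (\<lambda>\<omega>. (hybrid_value f C \<omega>)\<^sup>2)" for C
    by (subst integrable_distr_eq) (simp_all add: borel_prod[symmetric])
  from this[of A] this[of "{}"] show ?thesis
    using assms law_hybrid_pair_swap[of "{}" "{}" A] by (simp del: Diff_cancel)
qed

text \<open>
  With all coordinates exchanged, the hybrid sample is built from X (n+1), ..., X (2n) alone.
\<close>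

lemma indep_hybrid_value_copy:
  "indep_var borel (hybrid_value f {}) borel (hybrid_value f {1..n})"
proof -
  have "indep_var (PiM {1..n} (\<lambda>_. N)) (\<lambda>\<omega>. restrict (\<lambda>i. X i \<omega>) {1..n})
      (PiM {n+1..2*n} (\<lambda>_. N)) (\<lambda>\<omega>. restrict (\<lambda>i. X i \<omega>) {n+1..2*n})"
    by (intro indep_var_restrict[OF indep]) auto
  moreover have "(\<lambda>x. f (\<lambda>j\<in>{1..n}. x (n + j))) \<in> borel_measurable (PiM {n+1..2*n} (\<lambda>_. N))"
    by (rule measurable_compose[OF _ f], intro measurable_restrict measurable_component_singleton) auto
  ultimately have "indep_var borel (f \<circ> (\<lambda>\<omega>. restrict (\<lambda>i. X i \<omega>) {1..n}))
      borel ((\<lambda>x. f (\<lambda>j\<in>{1..n}. x (n + j))) \<circ> (\<lambda>\<omega>. restrict (\<lambda>i. X i \<omega>) {n+1..2*n}))"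
    using f by (intro indep_var_compose)
  moreover have "f \<circ> (\<lambda>\<omega>. restrict (\<lambda>i. X i \<omega>) {1..n}) = hybrid_value f {}"
    by (auto simp: fun_eq_iff hybrid_value_def hybrid_sample_def restrict_def)
  moreover have "(\<lambda>x. f (\<lambda>j\<in>{1..n}. x (n + j))) \<circ> (\<lambda>\<omega>. restrict (\<lambda>i. X i \<omega>) {n+1..2*n})
      = hybrid_value f {1..n}"
    by (auto simp: fun_eq_iff hybrid_value_def hybrid_sample_def intro!: arg_cong[of _ _ f])
  ultimately show ?thesis by simp
qed

text \<open>
  Write U A for the value of f at the sample whose coordinates in A are replaced by copies, and
  k A = E (U {} * U A). By exchangeability E (U A * U B) depends on the symmetric difference of A and
  B only and equals k of it. The variance is k {} - k {1..n}, by independence of U {} and U {1..n}.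
  For i outside A, expanding E (U {} - U {i} - U A + U (insert i A))^2 \<ge> 0 gives
  k A - k (insert i A) \<le> k {} - k {i}, so telescoping bounds the variance by the sum of the
  k {} - k {i}. Each of these is half of E (U {i} - U {})^2, and this half is the expectation of
  the squared positive part of U {i} - U {}, since U {i} - U {} has a symmetric law.
\<close>

theorem efron_stein:
  assumes sq: "integrable M (\<lambda>\<omega>. (hybrid_value f {} \<omega>)\<^sup>2)"
  shows "variance (hybrid_value f {})
    \<le> (\<Sum>i=1..n. expectation (\<lambda>\<omega>. (max 0 (hybrid_value f {i} \<omega> - hybrid_value f {} \<omega>))\<^sup>2))"
proof -
  let ?U = "hybrid_value f"
  note U2 = integrable_hybrid_value_power2[OF sq]
  have UU [simp]: "integrable M (\<lambda>\<omega>. ?U A \<omega> * ?U B \<omega>)" for A B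
  proof (rule Bochner_Integration.integrable_bound[OF Bochner_Integration.integrable_add[OF U2[of A] U2[of B]]])
    have "\<bar>a * b\<bar> \<le> a\<^sup>2 + b\<^sup>2" for a b :: real
      proof -
      have "0 \<le> \<bar>a\<bar> * \<bar>b\<bar>" by simp
      then show ?thesis
        using sum_squares_bound[of "\<bar>a\<bar>" "\<bar>b\<bar>"] unfolding abs_mult power2_abs by linarith
    qed
    then show "AE \<omega> in M. norm (?U A \<omega> * ?U B \<omega>) \<le> norm ((?U A \<omega>)\<^sup>2 + (?U B \<omega>)\<^sup>2)"
      by simp
  qed simp
  define k where "k A = expectation (\<lambda>\<omega>. ?U {} \<omega> * ?U A \<omega>)" for A
  have k: "expectation (\<lambda>\<omega>. ?U A \<omega> * ?U B \<omega>) = k ((B - A) \<union> (A - B))" for A B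
    using expectation_hybrid_pair_swap[of "\<lambda>p. fst p * snd p" A B A]
    by (simp add: k_def borel_prod[symmetric])
  have int1 [simp]: "integrable M (?U A)" for A
    by (rule square_integrable_imp_integrable) (simp_all add: U2)
  have var: "variance (?U {}) = k {} - k {1..n}"
  proof -
    have "expectation (?U {1..n}) = expectation (?U {})"
      using expectation_hybrid_pair_swap[of fst "{}" "{}" "{1..n}"] by (simp add: borel_prod[symmetric])
    then have "k {1..n} = (expectation (?U {}))\<^sup>2"
      unfolding k_def by (subst indep_var_lebesgue_integral[OF indep_hybrid_value_copy])
        (simp_all add: power2_eq_square)
    then show ?thesis
      by (subst variance_eq) (simp_all add: sq k_def power2_eq_square)
  qed
  have step: "k A - k (insert i A) \<le> k {} - k {i}" if "i \<notin> A" for A i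
  proof -
    let ?a = "?U {}" and ?b = "?U {i}" and ?c = "?U A" and ?d = "?U (insert i A)"
    have ab: "expectation (\<lambda>\<omega>. ?a \<omega> * ?b \<omega>) = k {i}" and ac: "expectation (\<lambda>\<omega>. ?a \<omega> * ?c \<omega>) = k A"
      and ad: "expectation (\<lambda>\<omega>. ?a \<omega> * ?d \<omega>) = k (insert i A)"
      by (simp_all add: k_def)
    have "({i} - A) \<union> (A - {i}) = insert i A" "(insert i A - {i}) \<union> ({i} - insert i A) = A"
      "(insert i A - A) \<union> (A - insert i A) = {i}"
      using that by auto
    with k[of A "{i}"] k[of "{i}" "insert i A"] k[of A "insert i A"]
    have bc: "expectation (\<lambda>\<omega>. ?c \<omega> * ?b \<omega>) = k (insert i A)"
      and bd: "expectation (\<lambda>\<omega>. ?b \<omega> * ?d \<omega>) = k A"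
      and cd: "expectation (\<lambda>\<omega>. ?c \<omega> * ?d \<omega>) = k {i}"
      by presburger+
    have sq: "expectation (\<lambda>\<omega>. ?U B \<omega> * ?U B \<omega>) = k {}" for B
      using k[of B B] by simp
    have "0 \<le> expectation (\<lambda>\<omega>. (?a \<omega> - ?b \<omega> - ?c \<omega> + ?d \<omega>)\<^sup>2)"
      by simp
    also have "(\<lambda>\<omega>. (?a \<omega> - ?b \<omega> - ?c \<omega> + ?d \<omega>)\<^sup>2) =
       (\<lambda>\<omega>. ?a \<omega> * ?a \<omega> + ?b \<omega> * ?b \<omega> + ?c \<omega> * ?c \<omega> + ?d \<omega> * ?d \<omega>
          - 2 * (?a \<omega> * ?b \<omega>) - 2 * (?a \<omega> * ?c \<omega>) + 2 * (?a \<omega> * ?d \<omega>) + 2 * (?c \<omega> * ?b \<omega>)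
          - 2 * (?b \<omega> * ?d \<omega>) - 2 * (?c \<omega> * ?d \<omega>))"
      by (auto simp: fun_eq_iff power2_eq_square algebra_simps)
    also have "expectation \<dots> = 4 * k {} - 4 * k {i} - 4 * k A + 4 * k (insert i A)"
      by (simp add: ab ac ad bc bd cd sq)
    finally show ?thesis by simp
  qed
  have swap_one: "k {} - k {i} = expectation (\<lambda>\<omega>. (max 0 (?U {i} \<omega> - ?U {} \<omega>))\<^sup>2)" for i
  proof -
    have pos_int [simp]: "integrable M (\<lambda>\<omega>. (max 0 (?U A \<omega> - ?U B \<omega>))\<^sup>2)" for A B
    proof (rule Bochner_Integration.integrable_bound)
      show "integrable M (\<lambda>\<omega>. ?U A \<omega> * ?U A \<omega> + ?U B \<omega> * ?U B \<omega> - 2 * (?U A \<omega> * ?U B \<omega>))"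
        by simp
      show "AE \<omega> in M. norm ((max 0 (?U A \<omega> - ?U B \<omega>))\<^sup>2)
          \<le> norm (?U A \<omega> * ?U A \<omega> + ?U B \<omega> * ?U B \<omega> - 2 * (?U A \<omega> * ?U B \<omega>))"
      proof (rule AE_I2)
        fix \<omega>
        have "(max 0 (a - b))\<^sup>2 \<le> a * a + b * b - 2 * (a * b)" for a b :: real
        proof -
          have "a * a + b * b - 2 * (a * b) = (a - b)\<^sup>2"
            by (simp add: power2_eq_square algebra_simps)
          then show ?thesis by (simp add: max_def)
        qed
        then show "norm ((max 0 (?U A \<omega> - ?U B \<omega>))\<^sup>2)
          \<le> norm (?U A \<omega> * ?U A \<omega> + ?U B \<omega> * ?U B \<omega> - 2 * (?U A \<omega> * ?U B \<omega>))"
          by (smt (verit) real_norm_def zero_le_power2)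
      qed
    qed simp
    have "2 * (k {} - k {i}) = expectation (\<lambda>\<omega>. ?U {} \<omega> * ?U {} \<omega> + ?U {i} \<omega> * ?U {i} \<omega> - 2 * (?U {} \<omega> * ?U {i} \<omega>))"
      by (simp add: k)
    also have "\<dots> = expectation (\<lambda>\<omega>. (max 0 (?U {i} \<omega> - ?U {} \<omega>))\<^sup>2 + (max 0 (?U {} \<omega> - ?U {i} \<omega>))\<^sup>2)"
      by (intro Bochner_Integration.integral_cong) (auto simp: max_def power2_eq_square algebra_simps)
    also have "\<dots> = expectation (\<lambda>\<omega>. (max 0 (?U {i} \<omega> - ?U {} \<omega>))\<^sup>2) + expectation (\<lambda>\<omega>. (max 0 (?U {} \<omega> - ?U {i} \<omega>))\<^sup>2)"
      by simp
    also have "expectation (\<lambda>\<omega>. (max 0 (?U {} \<omega> - ?U {i} \<omega>))\<^sup>2) = expectation (\<lambda>\<omega>. (max 0 (?U {i} \<omega> - ?U {} \<omega>))\<^sup>2)"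
      using expectation_hybrid_pair_swap[of "\<lambda>p. (max 0 (fst p - snd p))\<^sup>2" "{}" "{i}" "{i}"] by (simp add: borel_prod[symmetric])
    finally show ?thesis by simp
  qed
  have "k {} - k {1..m} \<le> (\<Sum>i=1..m. k {} - k {i})" for m
  proof (induction m)
    case (Suc m)
    then show ?case
      using step[of "Suc m" "{1..m}"] by (simp add: atLeastAtMostSuc_conv)
  qed simp
  then show ?thesis
    unfolding var by (simp add: swap_one)
qed

end
end

section \<open>The variance bound\<close>

text \<open>
  The copies X (n + i) play the role of the resampled points x' i. For i \<noteq> j the pair
  (X i, X j) has the same law as (X 1, X 2), which turns the expectation of the pointwise bound into
  the stated constant.
\<close>

theorem theorem3p1:
  fixes P Q :: "(real ^ 'd) measure"
    and M :: "'w measure"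
    and X :: "nat \<Rightarrow> 'w \<Rightarrow> real ^ 'd"
    and n :: nat
  assumes "prob_space P" and "sets P = sets borel"
    and "prob_space Q" and "sets Q = sets borel"
    and "integrable P (\<lambda>x. norm x ^ 4)"
    and "integrable Q (\<lambda>y. norm y ^ 4)"
    and "\<exists>f. f \<in> borel_measurable lborel \<and> Q = density lborel f"
    and "prob_space M"
    and "prob_space.indep_vars M (\<lambda>_. borel) X {1..}"
    and "\<And>i. i \<ge> 1 \<Longrightarrow> distr M borel (X i) = P"
    and "n \<ge> 1"
  defines "W \<equiv> \<lambda>\<omega>. enn2real (W2_sq (empirical_measure n (\<lambda>i. X i \<omega>)) Q)"
  shows "integrable M W \<and> integrable M (\<lambda>\<omega>. (W \<omega>)\<^sup>2) \<and>
    prob_space.variance M W \<le>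
      8 * (prob_space.expectation M (\<lambda>\<omega>. (norm (X 1 \<omega> - X 2 \<omega>))\<^sup>2 * (norm (X 1 \<omega>))\<^sup>2)
           + sqrt (prob_space.expectation M (\<lambda>\<omega>. norm (X 1 \<omega> - X 2 \<omega>) ^ 4))
             * sqrt (\<integral>y. norm y ^ 4 \<partial>Q)) / real n"
proof -
  note n = \<open>n \<ge> 1\<close>
  interpret Q: prob_space Q by fact
  interpret fourth_moment_target Q
    by (intro fourth_moment_target.intro target_measure.intro target_measure_axioms.intro
        fourth_moment_target_axioms.intro assms)
  interpret iid_sample M X borel P n
    by (intro iid_sample.intro iid_sample_axioms.intro assms)
  define f where "f = empirical_W2_sq Q n"
  have f [measurable]: "f \<in> borel_measurable (PiM {1..n} (\<lambda>_. borel))"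
    unfolding f_def by (rule empirical_W2_sq_measurable[OF n])
  have W_eq: "W = hybrid_value f {}"
    unfolding W_def hybrid_value_def f_def empirical_W2_sq_def[symmetric] fun_eq_iff
    by (auto intro!: empirical_W2_sq_cong simp: hybrid_sample_def)
  have W_i: "hybrid_value f {i} \<omega> = f ((\<lambda>j. X j \<omega>)(i := X (n + i) \<omega>))" for i \<omega>
    unfolding hybrid_value_def f_def by (rule empirical_W2_sq_cong) (auto simp: hybrid_sample_def)
  have W_m [measurable]: "W \<in> borel_measurable M"
    unfolding W_eq by (rule hybrid_value_measurable[OF f])
  have Xm: "X i \<in> borel_measurable M" if "i \<ge> 1" for i
    by (rule X_measurable[OF that])
  have X4: "integrable M (\<lambda>\<omega>. norm (X i \<omega>) ^ 4)" if "i \<ge> 1" for i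
    using integrable_distr_eq[OF Xm[OF that], of "\<lambda>x. norm x ^ 4"] assms(5,10) that by simp
  have W_sq: "integrable M (\<lambda>\<omega>. (W \<omega>)\<^sup>2)"
  proof (rule Bochner_Integration.integrable_bound)
    define c where "c = 2 * real n * (\<integral>y. (norm y)\<^sup>2 \<partial>Q)"
    show "integrable M (\<lambda>\<omega>. 2 * (real n * (\<Sum>i=1..n. 4 * norm (X i \<omega>) ^ 4)) + 2 * c\<^sup>2)"
      using X4 by (intro Bochner_Integration.integrable_add integrable_mult_right Bochner_Integration.integrable_sum) auto
    show "AE \<omega> in M. norm ((W \<omega>)\<^sup>2) \<le> norm (2 * (real n * (\<Sum>i=1..n. 4 * norm (X i \<omega>) ^ 4)) + 2 * c\<^sup>2)"
    proof (rule AE_I2)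
      fix \<omega>
      define S where "S = (\<Sum>i=1..n. 2 * (norm (X i \<omega>))\<^sup>2)"
      have "W \<omega> \<le> S + c"
        using empirical_W2_sq_le[OF n, of "\<lambda>i. X i \<omega>"]
        unfolding W_def S_def c_def empirical_W2_sq_def .
      moreover have "0 \<le> W \<omega>" by (simp add: W_def)
      ultimately have "(W \<omega>)\<^sup>2 \<le> (S + c)\<^sup>2" by (intro power_mono)
      also have "\<dots> \<le> 2 * S\<^sup>2 + 2 * c\<^sup>2"
        using sum_squares_bound[of S c] by (simp add: power2_sum)
      also have "S\<^sup>2 \<le> real n * (\<Sum>i=1..n. (2 * (norm (X i \<omega>))\<^sup>2)\<^sup>2)"
        unfolding S_def using sum_squared_le_sum_of_squares[of "\<lambda>i. 2 * (norm (X i \<omega>))\<^sup>2" "{1..n}"] by (simp add: mult.commute)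
      finally show "norm ((W \<omega>)\<^sup>2) \<le> norm (2 * (real n * (\<Sum>i=1..n. 4 * norm (X i \<omega>) ^ 4)) + 2 * c\<^sup>2)"
        by (simp add: power_mult_distrib power_mult[symmetric])
    qed
  qed measurable
  have W_int: "integrable M W"
    by (rule square_integrable_imp_integrable[OF W_m W_sq])

  define d where "d i \<omega> = norm (X i \<omega> - X (n + i) \<omega>)" for i \<omega>
  define q where "q = (\<integral>y. norm y ^ 4 \<partial>Q)"
  define a where "a = expectation (\<lambda>\<omega>. (norm (X 1 \<omega> - X 2 \<omega>))\<^sup>2 * (norm (X 1 \<omega>))\<^sup>2)"
  define b where "b = expectation (\<lambda>\<omega>. norm (X 1 \<omega> - X 2 \<omega>) ^ 4)"
  define T where "T \<omega> = (\<Sum>i=1..n. (d i \<omega>)\<^sup>2 * ((norm (X i \<omega>))\<^sup>2 + (norm (X (n + i) \<omega>))\<^sup>2))" for \<omega>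
  define S where "S \<omega> = (\<Sum>i=1..n. d i \<omega> ^ 4)" for \<omega>
  have d_m: "d i \<in> borel_measurable M" if "i \<ge> 1" for i
    unfolding d_def[abs_def]
    by (rule measurable_compose[OF borel_measurable_diff[OF Xm Xm] borel_measurable_norm]) (use that in auto)
  have d4: "integrable M (\<lambda>\<omega>. d i \<omega> ^ 4)" if i: "i \<ge> 1" for i
  proof (rule Bochner_Integration.integrable_bound)
    show "integrable M (\<lambda>\<omega>. 8 * norm (X i \<omega>) ^ 4 + 8 * norm (X (n + i) \<omega>) ^ 4)"
      using X4[OF i] X4[of "n + i"] n by simp
    show "AE \<omega> in M. norm (d i \<omega> ^ 4) \<le> norm (8 * norm (X i \<omega>) ^ 4 + 8 * norm (X (n + i) \<omega>) ^ 4)"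
      unfolding d_def real_norm_def
      using norm_diff_power4_le[of "X i _" "X (n + i) _"] by (intro AE_I2) (simp only: abs_of_nonneg[OF zero_le_power[OF norm_ge_zero]], simp)
  qed (use d_m[OF i] in auto)
  have dX: "integrable M (\<lambda>\<omega>. (d i \<omega>)\<^sup>2 * (norm (X j \<omega>))\<^sup>2)" if i: "i \<ge> 1" and j: "j \<ge> 1" for i j
  proof (rule Bochner_Integration.integrable_bound)
    show "integrable M (\<lambda>\<omega>. d i \<omega> ^ 4 + norm (X j \<omega>) ^ 4)"
      using d4[OF i] X4[OF j] by simp
    have "s\<^sup>2 * t\<^sup>2 \<le> s ^ 4 + t ^ 4" for s t :: real
    proof -
      have "2 * (s\<^sup>2 * t\<^sup>2) \<le> s ^ 4 + t ^ 4" "0 \<le> s\<^sup>2 * t\<^sup>2"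
        using sum_squares_bound[of "s\<^sup>2" "t\<^sup>2"] by (simp_all add: power_mult[symmetric])
      then show ?thesis by linarith
    qed
    then show "AE \<omega> in M. norm ((d i \<omega>)\<^sup>2 * (norm (X j \<omega>))\<^sup>2) \<le> norm (d i \<omega> ^ 4 + norm (X j \<omega>) ^ 4)"
      by (simp add: abs_mult)
  qed (use d_m[OF i] Xm[OF j] in auto)
  have E_dX: "expectation (\<lambda>\<omega>. (d i \<omega>)\<^sup>2 * (norm (X i \<omega>))\<^sup>2) = a"
    and E_dX': "expectation (\<lambda>\<omega>. (d i \<omega>)\<^sup>2 * (norm (X (n + i) \<omega>))\<^sup>2) = a"
    and E_d4: "expectation (\<lambda>\<omega>. d i \<omega> ^ 4) = b" if i: "i \<ge> 1" for i
  proof -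
    have m1: "(\<lambda>z :: (real ^ 'd) \<times> (real ^ 'd). (norm (fst z - snd z))\<^sup>2 * (norm (fst z))\<^sup>2) \<in> borel_measurable (borel \<Otimes>\<^sub>M borel)"
      and m2: "(\<lambda>z :: (real ^ 'd) \<times> (real ^ 'd). norm (fst z - snd z) ^ 4) \<in> borel_measurable (borel \<Otimes>\<^sub>M borel)"
      by measurable
    show "expectation (\<lambda>\<omega>. (d i \<omega>)\<^sup>2 * (norm (X i \<omega>))\<^sup>2) = a"
      using expectation_pair[OF m1, of i "n + i"] i n by (simp add: d_def a_def)
    show "expectation (\<lambda>\<omega>. (d i \<omega>)\<^sup>2 * (norm (X (n + i) \<omega>))\<^sup>2) = a"
      using expectation_pair[OF m1, of "n + i" i] i n
      by (simp add: d_def a_def norm_minus_commute[of "X i _"])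
    show "expectation (\<lambda>\<omega>. d i \<omega> ^ 4) = b"
      using expectation_pair[OF m2, of i "n + i"] i n by (simp add: d_def b_def)
  qed
  have T_int: "integrable M T" and T_exp: "expectation T = 2 * real n * a"
  proof -
    have T_eq: "T = (\<lambda>\<omega>. \<Sum>i=1..n. (d i \<omega>)\<^sup>2 * (norm (X i \<omega>))\<^sup>2 + (d i \<omega>)\<^sup>2 * (norm (X (n + i) \<omega>))\<^sup>2)"
      by (simp add: T_def fun_eq_iff distrib_left)
    show "integrable M T"
      unfolding T_eq using dX by (intro Bochner_Integration.integrable_sum Bochner_Integration.integrable_add) auto
    show "expectation T = 2 * real n * a"
      unfolding T_eq using dX E_dX E_dX' by (subst Bochner_Integration.integral_sum) auto
  qed
  have S_int: "integrable M S"
    unfolding S_def using d4 by (intro Bochner_Integration.integrable_sum) auto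
  have S_exp: "expectation S = real n * b"
    unfolding S_def using d4 E_d4 by (subst Bochner_Integration.integral_sum) auto
  have S_nonneg: "0 \<le> S \<omega>" for \<omega> unfolding S_def by (intro sum_nonneg) simp
  have sqrt_S2: "integrable M (\<lambda>\<omega>. (sqrt (S \<omega>))\<^sup>2)"
    using S_int S_nonneg by simp
  have sqrt_S: "integrable M (\<lambda>\<omega>. sqrt (S \<omega>))"
    using S_int by (intro square_integrable_imp_integrable[OF _ sqrt_S2]) auto
  have E_sqrt: "expectation (\<lambda>\<omega>. sqrt (S \<omega>)) \<le> sqrt (real n * b)"
    using expectation_power2_le[OF sqrt_S sqrt_S2] S_nonneg S_exp by (simp add: real_le_rsqrt)

  let ?inc = "\<lambda>i \<omega>. (max 0 (hybrid_value f {i} \<omega> - hybrid_value f {} \<omega>))\<^sup>2"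
  let ?bound = "\<lambda>\<omega>. 4 / (real n)\<^sup>2 * T \<omega> + 8 / real n * (sqrt (S \<omega>) * sqrt (q / real n))"
  have pointwise: "(\<Sum>i=1..n. ?inc i \<omega>) \<le> ?bound \<omega>" for \<omega>
    using sum_resampling_increments[OF n, of "\<lambda>j. X j \<omega>" "\<lambda>j. X (n + j) \<omega>"]
    unfolding W_eq[symmetric] W_i T_def S_def d_def q_def
    by (simp add: f_def W_def empirical_W2_sq_def)
  have bound_int: "integrable M ?bound"
    using T_int sqrt_S by simp
  have inc_int: "integrable M (?inc i)" if i: "i \<in> {1..n}" for i
  proof (rule Bochner_Integration.integrable_bound[OF bound_int])
    show "?inc i \<in> borel_measurable M"
      using hybrid_value_measurable[OF f] by auto
    have "?inc i \<omega> \<le> (\<Sum>i=1..n. ?inc i \<omega>)" for \<omega>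
      using i by (intro member_le_sum) auto
    then have "?inc i \<omega> \<le> ?bound \<omega>" for \<omega>
      by (rule order_trans[OF _ pointwise])
    then show "AE \<omega> in M. norm (?inc i \<omega>) \<le> norm (?bound \<omega>)"
      by (intro AE_I2) (smt (verit) real_norm_def zero_le_power2)
  qed
  have "variance W \<le> (\<Sum>i=1..n. expectation (?inc i))"
    unfolding W_eq by (rule efron_stein[OF f]) (use W_sq in \<open>simp add: W_eq\<close>)
  also have "\<dots> = expectation (\<lambda>\<omega>. \<Sum>i=1..n. ?inc i \<omega>)"
    using inc_int by (intro Bochner_Integration.integral_sum[symmetric]) auto
  also have "\<dots> \<le> expectation ?bound"
    using inc_int bound_int pointwise by (intro integral_mono Bochner_Integration.integrable_sum) auto
  also have "\<dots> = 4 / (real n)\<^sup>2 * (2 * real n * a) + 8 / real n * (expectation (\<lambda>\<omega>. sqrt (S \<omega>)) * sqrt (q / real n))"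
    using T_int sqrt_S by (simp add: T_exp)
  also have "\<dots> \<le> 4 / (real n)\<^sup>2 * (2 * real n * a) + 8 / real n * (sqrt (real n * b) * sqrt (q / real n))"
    using E_sqrt by (intro add_left_mono mult_left_mono mult_right_mono) (auto simp: q_def)
  also have "sqrt (real n * b) * sqrt (q / real n) = sqrt b * sqrt q"
    using n by (simp add: real_sqrt_mult real_sqrt_divide)
  also have "4 / (real n)\<^sup>2 * (2 * real n * a) + 8 / real n * (sqrt b * sqrt q) = 8 * (a + sqrt b * sqrt q) / real n"
    using n by (simp add: power2_eq_square field_simps)
  finally show ?thesis
    using W_int W_sq unfolding a_def b_def q_def by simp
qed

end
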